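(* Consider the fully composite problem $\varphi^*=\min_{x\in\operatorname{dom}\varphi}\{\varphi(x)=F(x,f(x))\}$ with subhomogeneous outer function (see context). For solving this problem with $\varepsilon$-accuracy, $$\varphi(x_K)-\varphi^*\le\varepsilon,$$ we need to perform $$K=O\Big(\Big[\frac{F(L_2(f))\|x_0-x^*\|^3}{\varepsilon}\Big]^{1/3}\Big)$$ iterations of the Fully Composite Contracting Proximal-Point Scheme described in the context. At each iteration, it requires no more than $$N=O\Big(1+\log\Big[\frac{F(L_2(f))\|x_0-x^*\|^3}{\varepsilon}\Big]\Big)$$ steps of the basic Fully Composite Cubic Newton Method (see context).
   Context: $\mathbb{E}$ is a finite-dimensional real vector space with norm $\|x\|=\langle Bx,x\rangle^{1/2}$, where $B:\mathbb{E}\to\mathbb{E}^*$ is self-adjoint positive definite. $O(\cdot)$ hides absolute constants, and $\approx$ means equality up to an absolute constant factor. Fully composite problem: $F:\mathbb{E}\times\mathbb{R}^m\to\mathbb{R}\cup\{+\infty\}$ is closed and convex on its domain, and for any $x\in\mathbb{E}$ for which $\mathcal{D}(x)=\{u\in\mathbb{R}^m:F(x,u)<+\infty\}$ is nonempty, $F(x,\cdot)$ is closed, convex and monotone on $\mathcal{D}(x)$ ($u\le v$ componentwise implies $F(x,u)\le F(x,v)$). $f=(f_1,\dots,f_m)^T:\operatorname{dom} f\to\mathbb{R}^m$, $\operatorname{dom} f\subseteq\mathbb{E}$ open and convex; all $f_i$ are closed, convex and twice continuously differentiable with Lipschitz continuous Hessian. $\varphi(x)=F(x,f(x))$, $\operatorname{dom}\varphi=\{x\in\operatorname{dom}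 f:F(x,f(x))<+\infty\}$; a solution $x^*$ with $\varphi(x^* )=\varphi^*$ is assumed to exist. Subhomogeneity: for any $x\in\operatorname{dom}\varphi$, $F(x,u)$ is subhomogeneous in $u\in\mathbb{R}^m$, so that $F(x,u+tv)\le F(x,u)+tF(x,v)$ for all $u,v\in\mathbb{R}^m$, $t\ge0$. $L_2(f_i)$ is a Lipschitz constant of $\nabla^2f_i$ (operator norm w.r.t. $\|\cdot\|$); $L_2(f)=(L_2(f_1),\dots,L_2(f_m))^T$; $F(L_2(f))=\sup_{x\in\operatorname{dom}\varphi}F(x,L_2(f))$. $\Omega_2(g,x;y)=g(x)+\langle\nabla g(x),y-x\rangle+\frac12\langle\nabla^2g(x)(y-x),y-x\rangle$ (componentwise). Prox-function: $d(x)=\frac\alpha3\|x-x_0\|^3$ with $\alpha=F(L_2(f))$, and Bregman divergence $\rho_d(x;y)=d(y)-d(x)-\langle\nabla d(x),y-x\rangle$. Scheme: choose $x_0\in\operatorname{dom}\varphi$ and accuracy $\delta\approx\min\{\varepsilon,\varepsilon^2/\rho_d(x_0;x^* )\}$; set $v_0=x_0$, $A_0=0$. For $k\ge0$: (1) $A_{k+1}=\big(\frac{k+1}3\big)^3$, $\gamma_k=\frac{A_{k+1}-A_k}{A_{k+1}}$; (2) form $h_{k+1}(x)=A_{k+1}\varphi(\gamma_kx+(1-\gamma_k)x_k)+\rho_d(v_k;x)$; (3) find a point $v_{k+1}$ such that $h_{k+1}(v_{k+1})-h_{k+1}^*\le\delta$, where $h_{k+1}^*$ is the minimal value of $h_{k+1}$,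 by the basic Cubic Newton Method; (4) $x_{k+1}=\gamma_kv_{k+1}+(1-\gamma_k)x_k$. Cubic Newton Method on the subproblem: with $\bar f(x)=f(\gamma_kx+(1-\gamma_k)x_k)$ and $\bar F(x,u)=A_{k+1}F(\gamma_kx+(1-\gamma_k)x_k,u)+\rho_d(v_k;x)$, the subproblem is $h_{k+1}(x)=\bar F(x,\bar f(x))\to\min_{x\in\operatorname{dom}\varphi}$, and the steps are $$z_{t+1}=\operatorname*{argmin}_{x\in\operatorname{dom}\varphi}\Big\{\bar F\big(x,\Omega_2(\bar f,z_t;x)\big)+\frac{\bar F(L_2(\bar f))}6\|x-z_t\|^3\Big\},\qquad t\ge0,\quad z_0=v_k,$$ where $\bar F(L_2(\bar f))$ is defined for $\bar F,\bar f$ as $F(L_2(f))$ is for $F,f$.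
   Formalization: F̄(L_2(f̄)) is replaced by sup_x A_{k+1}γ_k^3 F(γ_k x+(1-γ_k)x_k, L_2(f)), dropping ρ_d, whose sup can be infinite; F(x,·) is monotone in extended values (D(x) downward closed); F(L_2(f)) is finite; the bound on K is at least 1 and the log is cut off at 0. *)

theory Defs
  imports "HOL-Analysis.Analysis"
begin

section \<open>The Euclidean structure given by an operator into the dual space\<close>

text \<open>
  The type \<^typ>\<open>'e::euclidean_space\<close> is used only as a finite-dimensional real vector space with
  its canonical topology.  The norm of the problem comes from \<open>B\<close>, and \<^typ>\<open>'e \<Rightarrow>\<^sub>L real\<close>
  is the dual space, with the pairing written as application.
\<close>

definition spd :: "('e::euclidean_space \<Rightarrow> ('e \<Rightarrow>\<^sub>L real)) \<Rightarrow> bool" where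
  "spd B \<longleftrightarrow> linear B \<and> (\<forall>x y. B x y = B y x) \<and> (\<forall>x. x \<noteq> 0 \<longrightarrow> B x x > 0)"

definition nrm :: "('e::euclidean_space \<Rightarrow> ('e \<Rightarrow>\<^sub>L real)) \<Rightarrow> 'e \<Rightarrow> real" where
  "nrm B x = sqrt (B x x)"

definition dual_nrm :: "('e::euclidean_space \<Rightarrow> ('e \<Rightarrow>\<^sub>L real)) \<Rightarrow> ('e \<Rightarrow>\<^sub>L real) \<Rightarrow> real" where
  "dual_nrm B s = (SUP h\<in>{h. nrm B h \<le> 1}. s h)"

definition op_nrm :: "('e::euclidean_space \<Rightarrow> ('e \<Rightarrow>\<^sub>L real)) \<Rightarrow> ('e \<Rightarrow>\<^sub>L ('e \<Rightarrow>\<^sub>L real)) \<Rightarrow> real" where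
  "op_nrm B T = (SUP h\<in>{h. nrm B h \<le> 1}. dual_nrm B (T h))"

section \<open>Derivatives and the second-order Taylor model\<close>

definition grad :: "('e::euclidean_space \<Rightarrow> 'b::real_normed_vector) \<Rightarrow> 'e \<Rightarrow> ('e \<Rightarrow>\<^sub>L 'b)" where
  "grad g x = Blinfun (frechet_derivative g (at x))"

definition hess :: "('e::euclidean_space \<Rightarrow> real) \<Rightarrow> 'e \<Rightarrow> ('e \<Rightarrow>\<^sub>L ('e \<Rightarrow>\<^sub>L real))" where
  "hess g = grad (grad g)"

definition twice_cont_diff :: "'e::euclidean_space set \<Rightarrow> ('e \<Rightarrow> real) \<Rightarrow> bool" where
  "twice_cont_diff U g \<longleftrightarrow>
     (\<forall>x\<in>U. g differentiable at x) \<and> (\<forall>x\<in>U. grad g differentiable at x) \<and>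
     continuous_on U (hess g)"

definition hess_lipschitz ::
  "('e::euclidean_space \<Rightarrow> ('e \<Rightarrow>\<^sub>L real)) \<Rightarrow> 'e set \<Rightarrow> ('e \<Rightarrow> real) \<Rightarrow> real \<Rightarrow> bool" where
  "hess_lipschitz B U g l \<longleftrightarrow>
     0 \<le> l \<and> (\<forall>x\<in>U. \<forall>y\<in>U. op_nrm B (hess g x - hess g y) \<le> l * nrm B (x - y))"

definition Omega2 :: "('e::euclidean_space \<Rightarrow> real ^ 'm) \<Rightarrow> 'e \<Rightarrow> 'e \<Rightarrow> real ^ 'm" where
  "Omega2 g x y = (\<chi> i. g x $ i + grad (\<lambda>z. g z $ i) x (y - x)
                        + 1 / 2 * hess (\<lambda>z. g z $ i) x (y - x) (y - x))"

definition bregman :: "('e::euclidean_space \<Rightarrow> real) \<Rightarrow> 'e \<Rightarrow> 'e \<Rightarrow> real" where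
  "bregman d x y = d y - d x - grad d x (y - x)"

section \<open>The fully composite problem\<close>

definition closed_convex :: "('a::real_normed_vector \<Rightarrow> ereal) \<Rightarrow> bool" where
  "closed_convex g \<longleftrightarrow> closed {(x, t). g x \<le> ereal t} \<and> convex {(x, t). g x \<le> ereal t}"

text \<open>
  Monotonicity is between extended values, so each nonempty set \<open>{u. F x u < \<infinity>}\<close> is downward closed.
\<close>

definition outer_fun :: "('e::euclidean_space \<Rightarrow> real ^ 'm \<Rightarrow> ereal) \<Rightarrow> bool" where
  "outer_fun F \<longleftrightarrow>
     (\<forall>x u. F x u \<noteq> -\<infinity>) \<and>
     closed_convex (\<lambda>(x, u). F x u) \<and>
     (\<forall>x. {u. F x u < \<infinity>} \<noteq> {} \<longrightarrow>
        closed_convex (F x) \<and> (\<forall>u v. (\<forall>i. u $ i \<le> v $ i) \<longrightarrow> F x u \<le> F x v))"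

text \<open>
  \<open>U\<close> is the domain of the inner map \<open>f\<close>, whose values outside \<open>U\<close> are irrelevant; \<open>L $ i\<close> is a
  Lipschitz constant of the Hessian of the \<open>i\<close>-th component.
\<close>

definition inner_map ::
  "('e::euclidean_space \<Rightarrow> ('e \<Rightarrow>\<^sub>L real)) \<Rightarrow> 'e set \<Rightarrow> ('e \<Rightarrow> real ^ 'm) \<Rightarrow> real ^ 'm \<Rightarrow> bool" where
  "inner_map B U f L \<longleftrightarrow>
     open U \<and> convex U \<and>
     (\<forall>i. closed (epigraph U (\<lambda>x. f x $ i)) \<and> convex_on U (\<lambda>x. f x $ i) \<and>
          twice_cont_diff U (\<lambda>x. f x $ i) \<and> hess_lipschitz B U (\<lambda>x. f x $ i) (L $ i))"

definition phi ::
  "('e::euclidean_space \<Rightarrow> real ^ 'm \<Rightarrow> ereal) \<Rightarrow> 'e set \<Rightarrow> ('e \<Rightarrow> real ^ 'm) \<Rightarrow> 'e \<Rightarrow> ereal" where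
  "phi F U f x = (if x \<in> U then F x (f x) else \<infinity>)"

definition dom_phi ::
  "('e::euclidean_space \<Rightarrow> real ^ 'm \<Rightarrow> ereal) \<Rightarrow> 'e set \<Rightarrow> ('e \<Rightarrow> real ^ 'm) \<Rightarrow> 'e set" where
  "dom_phi F U f = {x \<in> U. F x (f x) < \<infinity>}"

definition subhomogeneous_on :: "'e set \<Rightarrow> ('e::euclidean_space \<Rightarrow> real ^ 'm \<Rightarrow> ereal) \<Rightarrow> bool" where
  "subhomogeneous_on S F \<longleftrightarrow>
     (\<forall>x\<in>S. \<forall>u v. \<forall>t\<ge>0. F x (u + t *\<^sub>R v) \<le> F x u + ereal t * F x v)"

definition F_sup :: "'e set \<Rightarrow> ('e::euclidean_space \<Rightarrow> real ^ 'm \<Rightarrow> ereal) \<Rightarrow> real ^ 'm \<Rightarrow> ereal" where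
  "F_sup S F w = (SUP x\<in>S. F x w)"

section \<open>The contracting proximal-point scheme\<close>

definition Acoef :: "nat \<Rightarrow> real" where
  "Acoef k = (real k / 3) ^ 3"

definition gam :: "nat \<Rightarrow> real" where
  "gam k = (Acoef (Suc k) - Acoef k) / Acoef (Suc k)"

definition contract :: "nat \<Rightarrow> 'e::euclidean_space \<Rightarrow> 'e \<Rightarrow> 'e" where
  "contract k xk x = gam k *\<^sub>R x + (1 - gam k) *\<^sub>R xk"

definition prox_fun :: "('e::euclidean_space \<Rightarrow> ('e \<Rightarrow>\<^sub>L real)) \<Rightarrow> real \<Rightarrow> 'e \<Rightarrow> 'e \<Rightarrow> real" where
  "prox_fun B \<alpha> x0 x = \<alpha> / 3 * nrm B (x - x0) ^ 3"

definition h_obj ::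
  "('e::euclidean_space \<Rightarrow> real ^ 'm \<Rightarrow> ereal) \<Rightarrow> 'e set \<Rightarrow> ('e \<Rightarrow> real ^ 'm) \<Rightarrow> ('e \<Rightarrow> real)
    \<Rightarrow> nat \<Rightarrow> 'e \<Rightarrow> 'e \<Rightarrow> 'e \<Rightarrow> ereal" where
  "h_obj F U f d k xk vk x =
     ereal (Acoef (Suc k)) * phi F U f (contract k xk x) + ereal (bregman d vk x)"

definition accurate_min :: "'e set \<Rightarrow> ('e \<Rightarrow> ereal) \<Rightarrow> real \<Rightarrow> 'e \<Rightarrow> bool" where
  "accurate_min S h \<delta> v \<longleftrightarrow> v \<in> S \<and> h v - (INF y\<in>S. h y) \<le> ereal \<delta>"

definition f_bar :: "('e::euclidean_space \<Rightarrow> real ^ 'm) \<Rightarrow> nat \<Rightarrow> 'e \<Rightarrow> 'e \<Rightarrow> real ^ 'm" where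
  "f_bar f k xk x = f (contract k xk x)"

definition F_bar ::
  "('e::euclidean_space \<Rightarrow> real ^ 'm \<Rightarrow> ereal) \<Rightarrow> ('e \<Rightarrow> real)
    \<Rightarrow> nat \<Rightarrow> 'e \<Rightarrow> 'e \<Rightarrow> 'e \<Rightarrow> real ^ 'm \<Rightarrow> ereal" where
  "F_bar F d k xk vk x u =
     ereal (Acoef (Suc k)) * F (contract k xk x) u + ereal (bregman d vk x)"

text \<open>
  The regularization parameter of the cubic Newton steps on the subproblem.  The Hessian of
  \<^const>\<open>f_bar\<close> has Lipschitz constants \<open>gam k ^ 3 *\<^sub>R L\<close>.  The scalar \<open>gam k ^ 3\<close> stands outside
  \<open>F\<close>, as in the term \<open>t * F x v\<close> of subhomogeneity, and the Bregman term of \<^const>\<open>F_bar\<close>, which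
  does not depend on \<open>u\<close>, is left out.  With this \<open>M\<close>, subhomogeneity of \<open>F\<close> gives
  \<open>F_bar x (u + t *\<^sub>R (gam k ^ 3 *\<^sub>R L)) \<le> F_bar x u + t * M\<close>.  The supremum of
  \<open>F_bar x (gam k ^ 3 *\<^sub>R L)\<close> itself would contain the supremum of the Bregman term, which is
  infinite on an unbounded domain.
\<close>

definition newton_const ::
  "('e::euclidean_space \<Rightarrow> real ^ 'm \<Rightarrow> ereal) \<Rightarrow> 'e set \<Rightarrow> ('e \<Rightarrow> real ^ 'm) \<Rightarrow> real ^ 'm
    \<Rightarrow> nat \<Rightarrow> 'e \<Rightarrow> ereal" where
  "newton_const F U f L k xk =
     F_sup (dom_phi F U f)
       (\<lambda>x u. ereal (Acoef (Suc k)) * (ereal (gam k ^ 3) * F (contract k xk x) u)) L"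

definition cubic_newton ::
  "('e::euclidean_space \<Rightarrow> ('e \<Rightarrow>\<^sub>L real)) \<Rightarrow> ('e \<Rightarrow> real ^ 'm \<Rightarrow> ereal) \<Rightarrow> 'e set
    \<Rightarrow> ('e \<Rightarrow> real ^ 'm) \<Rightarrow> real ^ 'm \<Rightarrow> ('e \<Rightarrow> real)
    \<Rightarrow> nat \<Rightarrow> 'e \<Rightarrow> 'e \<Rightarrow> nat \<Rightarrow> (nat \<Rightarrow> 'e) \<Rightarrow> bool" where
  "cubic_newton B F U f L d k xk vk n z \<longleftrightarrow>
     z 0 = vk \<and>
     (\<forall>t<n. is_arg_min
        (\<lambda>x. F_bar F d k xk vk x (Omega2 (f_bar f k xk) (z t) x)
              + newton_const F U f L k xk / 6 * ereal (nrm B (x - z t) ^ 3))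
        (\<lambda>x. x \<in> dom_phi F U f) (z (Suc t)))"

text \<open>\<open>K\<close> iterations of the scheme, with outer points \<open>x\<close> and prox-centers \<open>v\<close>.\<close>

definition contracting_scheme ::
  "('e::euclidean_space \<Rightarrow> ('e \<Rightarrow>\<^sub>L real)) \<Rightarrow> ('e \<Rightarrow> real ^ 'm \<Rightarrow> ereal) \<Rightarrow> 'e set
    \<Rightarrow> ('e \<Rightarrow> real ^ 'm) \<Rightarrow> real ^ 'm \<Rightarrow> ('e \<Rightarrow> real)
    \<Rightarrow> 'e \<Rightarrow> real \<Rightarrow> nat \<Rightarrow> (nat \<Rightarrow> 'e) \<Rightarrow> (nat \<Rightarrow> 'e) \<Rightarrow> bool" where
  "contracting_scheme B F U f L d x0 \<delta> K x v \<longleftrightarrow>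
     x 0 = x0 \<and> v 0 = x0 \<and>
     (\<forall>k<K.
        (\<exists>n z. cubic_newton B F U f L d k (x k) (v k) n z \<and> v (Suc k) = z n) \<and>
        accurate_min (dom_phi F U f) (h_obj F U f d k (x k) (v k)) \<delta> (v (Suc k)) \<and>
        x (Suc k) = gam k *\<^sub>R v (Suc k) + (1 - gam k) *\<^sub>R x k)"

text \<open>\<open>min {\<epsilon>, \<epsilon>\<^sup>2 / \<rho>}\<close> with the quotient read as \<open>\<infinity>\<close> for \<open>\<rho> = 0\<close>.\<close>

definition base_accuracy :: "real \<Rightarrow> real \<Rightarrow> real" where
  "base_accuracy \<epsilon> \<rho> = (if \<rho> = 0 then \<epsilon> else min \<epsilon> (\<epsilon>\<^sup>2 / \<rho>))"

end

theory Submission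
  imports Defs
begin

text \<open>
  The argument follows the potential
  \<open>A\<^sub>k (\<phi> (x\<^sub>k) - \<phi>\<^sup>*) + \<rho>\<^sub>d (v\<^sub>k; x\<^sup>*)\<close>, whose initial value is
  \<open>\<rho>\<^sub>d (x\<^sub>0; x\<^sup>*) = X * \<epsilon> / 3\<close>.

  Outer iterations.  If \<open>v\<^sub>k\<^sub>+\<^sub>1\<close> minimized the subproblem exactly, the potential would not increase.
  For a \<open>\<delta>\<close>-approximate minimizer, the comparison with the point that lies on the way from \<open>v\<^sub>k\<^sub>+\<^sub>1\<close>
  to \<open>x\<^sup>*\<close> at fraction \<open>\<tau>\<close> replaces the first-order optimality condition
  (\<open>inexact_prox_step\<close>).  It costs \<open>\<delta> / \<tau>\<close> plus \<open>\<tau>\<close> times a multiple of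
  the potential, so \<open>\<tau>\<close> proportional to \<open>1 / K\<close> keeps the potential below
  \<open>2 (\<rho>\<^sub>d (x\<^sub>0; x\<^sup>*) + 134 K\<^sup>2 \<delta>)\<close> for \<open>K\<close> iterations (\<open>potential_bound\<close>).  Division by
  \<open>A\<^sub>K = (K / 3)\<^sup>3\<close> gives the accuracy \<open>\<epsilon>\<close> as soon as \<open>A\<^sub>K\<close> reaches \<open>X\<close>, since \<open>\<delta>\<close> is a
  tiny fraction of \<open>\<epsilon>\<close>.

  Newton steps.  The coefficients satisfy \<open>A\<^sub>k\<^sub>+\<^sub>1 \<gamma>\<^sub>k\<^sup>3 \<le> 1\<close>, hence the regularization parameter of the
  subproblem is at most \<open>\<alpha> = F (L\<^sub>2 (f))\<close>, the factor of the prox-function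
  (\<open>newton_const_real\<close>).  The cubic prox-function is uniformly convex of degree three
  with a constant proportional to \<open>\<alpha>\<close>, so the subproblem has an absolute condition number of third order
  and every Newton step reduces the gap in the objective by the factor \<open>7 / 8\<close>
  (\<open>cubic_step_contraction\<close>).  The gap at the starting point \<open>v\<^sub>k\<close> cannot be controlled, but the
  first step brings it below three times the potential (\<open>newton_gap\<close>).  The ratio of the potential to
  \<open>\<delta>\<close> is polynomial in \<open>X\<close>, which gives the logarithmic number of steps.
\<close>


section \<open>The norm of a positive definite operator\<close>

context
  fixes B :: "'e::euclidean_space \<Rightarrow> ('e \<Rightarrow>\<^sub>L real)"
  assumes spd: "spd B"
begin

lemma spd_linear_simps:
  "B (x + y) = B x + B y" "B (x - y) = B x - B y" "B (c *\<^sub>R x) = c *\<^sub>R B x" "B (- x) = - B x" "B 0 = 0"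
proof -
  have "linear B" using spd by (simp add: spd_def)
  then show "B (x + y) = B x + B y" "B (x - y) = B x - B y" "B (c *\<^sub>R x) = c *\<^sub>R B x"
    "B (- x) = - B x" "B 0 = 0"
    by (simp_all add: linear_add linear_diff linear_scale linear_neg linear_0)
qed

lemma spd_commute: "B x y = B y x"
  using spd unfolding spd_def by blast

lemma nrm_square: "(nrm B x)\<^sup>2 = B x x"
proof -
  have "0 \<le> B x x"
    using spd by (cases "x = 0") (auto simp: spd_def intro: less_imp_le)
  then show ?thesis by (simp add: nrm_def)
qed

lemma nrm_nonneg: "0 \<le> nrm B x"
  using nrm_square[of x] unfolding nrm_def by (metis real_sqrt_ge_0_iff zero_le_power2)

lemma nrm_eq_0_iff: "nrm B x = 0 \<longleftrightarrow> x = 0"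
  using spd nrm_square[of x] unfolding spd_def
  by (metis blinfun.zero_right less_numeral_extra(3) power_zero_numeral zero_eq_power2)

lemma nrm_scaleR: "nrm B (c *\<^sub>R x) = \<bar>c\<bar> * nrm B x"
  by (simp add: nrm_def spd_linear_simps blinfun.scaleR_left blinfun.scaleR_right real_sqrt_mult
      flip: mult.assoc)

lemma nrm_minus_commute: "nrm B (x - y) = nrm B (y - x)"
  using nrm_scaleR[of "-1" "x - y"] by simp

lemma nrm_add_square: "(nrm B (x + y))\<^sup>2 = (nrm B x)\<^sup>2 + 2 * B x y + (nrm B y)\<^sup>2"
  using spd_commute[of x y]
  by (simp add: nrm_square spd_linear_simps blinfun.add_left blinfun.add_right)

lemma spd_Cauchy_Schwarz: "\<bar>B x y\<bar> \<le> nrm B x * nrm B y"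
proof -
  have le: "B x y \<le> nrm B x * nrm B y" for x y
  proof (cases "x = 0 \<or> y = 0")
    case True
    then show ?thesis
      by (auto simp: spd_linear_simps nrm_def)
  next
    case False
    then have pos: "0 < nrm B x * nrm B y"
      using nrm_eq_0_iff nrm_nonneg by (metis less_eq_real_def mult_pos_pos)
    have "0 \<le> (nrm B (nrm B y *\<^sub>R x + (- nrm B x) *\<^sub>R y))\<^sup>2" by simp
    also have "\<dots> = 2 * (nrm B x * nrm B y) * (nrm B x * nrm B y - B x y)"
      unfolding nrm_add_square nrm_scaleR
      by (simp add: spd_linear_simps blinfun.scaleR_left blinfun.scaleR_right blinfun.minus_right
          nrm_nonneg power2_eq_square algebra_simps)
    finally show ?thesis using pos by (simp add: zero_le_mult_iff)
  qed
  have "B (- x) y \<le> nrm B x * nrm B y"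
    using le[of "- x" y] nrm_scaleR[of "-1" x] by simp
  then show ?thesis using le[of x y]
    by (simp add: spd_linear_simps blinfun.minus_left)
qed

lemma nrm_triangle: "nrm B (x + y) \<le> nrm B x + nrm B y"
proof (rule power2_le_imp_le)
  show "(nrm B (x + y))\<^sup>2 \<le> (nrm B x + nrm B y)\<^sup>2"
    using spd_Cauchy_Schwarz[of x y] by (simp add: nrm_add_square power2_sum)
qed (simp add: nrm_nonneg)

lemma nrm_le_norm: "\<exists>C>0. \<forall>x. nrm B x \<le> C * norm x"
proof -
  have "bounded_linear B"
    using spd by (simp add: spd_def linear_conv_bounded_linear)
  then obtain c where c: "c > 0" "\<And>x. norm (B x) \<le> norm x * c"
    using bounded_linear.pos_bounded by blast
  have "nrm B x \<le> sqrt c * norm x" for x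
  proof (rule power2_le_imp_le)
    have "B x x \<le> norm (B x) * norm x"
      using norm_blinfun[of "B x" x] by simp
    also have "\<dots> \<le> (norm x * c) * norm x"
      using c by (intro mult_right_mono) auto
    finally show "(nrm B x)\<^sup>2 \<le> (sqrt c * norm x)\<^sup>2"
      using c unfolding nrm_square power_mult_distrib by (simp add: power2_eq_square[of "norm x"] mult_ac)
  qed (use c in simp)
  then show ?thesis using c by (intro exI[of _ "sqrt c"]) auto
qed

lemma norm_le_nrm: "\<exists>C>0. \<forall>x. norm x \<le> C * nrm B x"
proof -
  obtain C where C: "C > 0" "\<And>x. nrm B x \<le> C * norm x" using nrm_le_norm by blast
  have cont: "continuous_on (sphere 0 1) (nrm B)"
  proof (rule continuous_onI)
    fix x :: 'e and e :: real assume "0 < e"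
    have "dist (nrm B y) (nrm B x) \<le> C * dist y x" for y
    proof -
      have "nrm B y \<le> nrm B (y - x) + nrm B x" "nrm B x \<le> nrm B (y - x) + nrm B y"
        using nrm_triangle[of "y - x" x] nrm_triangle[of "x - y" y] nrm_minus_commute[of x y]
        by simp_all
      then show ?thesis using C(2)[of "y - x"] by (simp add: dist_real_def dist_norm)
    qed
    then show "\<exists>r>0. \<forall>y\<in>sphere 0 1. dist y x < r \<longrightarrow> dist (nrm B y) (nrm B x) \<le> e"
      using \<open>0 < e\<close> C(1)
      by (intro exI[of _ "e / C"]) (smt (verit) divide_pos_pos mult.commute pos_less_divide_eq)
  qed
  obtain u :: 'e where u: "u \<in> sphere 0 1"
    using vector_choose_size[of 1] by (metis dist_0_norm mem_sphere zero_le_one)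
  obtain m where m: "m \<in> sphere 0 1" "\<And>y. y \<in> sphere 0 1 \<Longrightarrow> nrm B m \<le> nrm B y"
    using continuous_attains_inf[OF compact_sphere _ cont] u by blast
  have "m \<noteq> 0" using m by auto
  then have mpos: "0 < nrm B m" using nrm_nonneg nrm_eq_0_iff by (metis less_eq_real_def)
  have "norm x \<le> (1 / nrm B m) * nrm B x" for x
  proof (cases "x = 0")
    case False
    have "nrm B m \<le> nrm B ((1 / norm x) *\<^sub>R x)"
      using False by (intro m(2)) (simp add: dist_norm)
    then show ?thesis using False mpos by (simp add: nrm_scaleR field_simps)
  qed (simp add: nrm_nonneg mpos less_imp_le)
  then show ?thesis using mpos by (intro exI[of _ "1 / nrm B m"]) auto
qed

text \<open>
  A supremum of reals bounds its members only when the set is bounded; here this comes from the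
  equivalence of the two norms.
\<close>

lemma blinfun_le_op_nrm:
  fixes T :: "'e \<Rightarrow>\<^sub>L ('e \<Rightarrow>\<^sub>L real)"
  shows "T h h \<le> op_nrm B T * (nrm B h)\<^sup>2"
proof (cases "h = 0")
  case False
  then have pos: "0 < nrm B h" using nrm_nonneg nrm_eq_0_iff by (metis less_eq_real_def)
  obtain C where C: "C > 0" "\<And>x. norm x \<le> C * nrm B x" using norm_le_nrm by blast
  have norm_le: "norm x \<le> C" if "nrm B x \<le> 1" for x
    using C(2)[of x] C(1) that mult_left_mono[of "nrm B x" 1 C] by linarith
  have dual_bdd: "s x \<le> norm s * C" if "nrm B x \<le> 1" for s :: "'e \<Rightarrow>\<^sub>L real" and x
    using norm_blinfun[of s x] mult_left_mono[OF norm_le[OF that], of "norm s"] by simp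
  have dual_upper: "s x \<le> dual_nrm B s" if "nrm B x \<le> 1" for s :: "'e \<Rightarrow>\<^sub>L real" and x
    unfolding dual_nrm_def using that dual_bdd
    by (intro cSUP_upper bdd_aboveI2[where M = "norm s * C"]) auto
  have one: "nrm B 0 \<le> 1" using nrm_eq_0_iff[of 0] by simp
  have dual_le: "dual_nrm B s \<le> norm s * C" for s
    unfolding dual_nrm_def using dual_bdd one by (intro cSUP_least) auto
  have op_bdd: "dual_nrm B (T x) \<le> norm T * C * C" if "nrm B x \<le> 1" for x
  proof -
    have "norm (T x) \<le> norm T * C"
      using norm_blinfun[of T x] mult_left_mono[OF norm_le[OF that], of "norm T"] by simp
    then show ?thesis using dual_le[of "T x"] C(1) by (smt (verit) mult_right_mono)
  qed
  let ?u = "(1 / nrm B h) *\<^sub>R h"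
  have u: "nrm B ?u \<le> 1" using pos by (simp add: nrm_scaleR)
  have "T ?u ?u \<le> dual_nrm B (T ?u)" by (rule dual_upper[OF u])
  also have "\<dots> \<le> op_nrm B T"
    unfolding op_nrm_def using u op_bdd
    by (intro cSUP_upper bdd_aboveI2[where M = "norm T * C * C"]) auto
  finally show ?thesis using pos
    by (simp add: blinfun.scaleR_left blinfun.scaleR_right field_simps power2_eq_square)
qed (use nrm_eq_0_iff[of 0] in simp)

end


section \<open>Gradients\<close>

lemma has_derivative_grad:
  assumes "g differentiable at x"
  shows "(g has_derivative blinfun_apply (grad g x)) (at x)"
proof -
  have "(g has_derivative frechet_derivative g (at x)) (at x)"
    using assms by (simp add: frechet_derivative_works)
  then show ?thesis
    unfolding grad_def using bounded_linear_Blinfun_apply has_derivative_bounded_linear by metis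
qed

lemma grad_eqI:
  assumes "(g has_derivative blinfun_apply T) (at x)"
  shows "grad g x = T"
  by (simp add: grad_def blinfun_apply_inverse flip: frechet_derivative_at[OF assms])

section \<open>The cubic prox-function\<close>

text \<open>
  The Bregman divergence of \<open>(1 / 3) nrm B x ^ 3\<close> from \<open>a\<close> to \<open>a + s\<close>, with the value of the gradient
  written out, so that it can be estimated before differentiability is known.
\<close>

definition cubic_rem :: "('e::euclidean_space \<Rightarrow> ('e \<Rightarrow>\<^sub>L real)) \<Rightarrow> 'e \<Rightarrow> 'e \<Rightarrow> real" where
  "cubic_rem B a s = nrm B (a + s) ^ 3 / 3 - nrm B a ^ 3 / 3 - nrm B a * B a s"

context
  fixes B :: "'e::euclidean_space \<Rightarrow> ('e \<Rightarrow>\<^sub>L real)"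
  assumes spd: "spd B"
begin

text \<open>
  Eliminating the inner product leaves an expression in the three side lengths of a triangle, in which
  every term is nonnegative.
\<close>

lemma cubic_rem_eq:
  fixes a s defines "p \<equiv> nrm B a" and "q \<equiv> nrm B (a + s)" and "r \<equiv> nrm B s"
  shows "cubic_rem B a s = p * r\<^sup>2 / 2 + (q - p)\<^sup>2 * (2 * q + p) / 6"
proof -
  have "B a s = (q\<^sup>2 - p\<^sup>2 - r\<^sup>2) / 2"
    using nrm_add_square[OF spd, of a s] by (simp add: p_def q_def r_def)
  then have "cubic_rem B a s = q ^ 3 / 3 - p ^ 3 / 3 - p * ((q\<^sup>2 - p\<^sup>2 - r\<^sup>2) / 2)"
    by (simp add: cubic_rem_def p_def q_def)
  then show ?thesis by (simp add: field_simps power2_eq_square power3_eq_cube)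
qed

lemma nrm_three_points:
  "nrm B (a + s) \<le> nrm B a + nrm B s" "nrm B s \<le> nrm B a + nrm B (a + s)"
  "nrm B a \<le> nrm B (a + s) + nrm B s"
proof -
  show "nrm B (a + s) \<le> nrm B a + nrm B s" by (rule nrm_triangle[OF spd])
  have "nrm B s \<le> nrm B (a + s) + nrm B (- a)"
    using nrm_triangle[OF spd, of "a + s" "- a"] by simp
  then show "nrm B s \<le> nrm B a + nrm B (a + s)"
    using nrm_scaleR[OF spd, of "-1" a] by simp
  have "nrm B a \<le> nrm B (a + s) + nrm B (- s)"
    using nrm_triangle[OF spd, of "a + s" "- s"] by simp
  then show "nrm B a \<le> nrm B (a + s) + nrm B s"
    using nrm_scaleR[OF spd, of "-1" s] by simp
qed

lemma cubic_rem_le: "cubic_rem B a s \<le> nrm B a * (nrm B s)\<^sup>2 + nrm B s ^ 3 / 3"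
proof -
  define p q r where "p = nrm B a" and "q = nrm B (a + s)" and "r = nrm B s"
  have *: "0 \<le> p" "0 \<le> q" "0 \<le> r" "q \<le> p + r" "p \<le> q + r"
    using nrm_three_points[where a = a and s = s] nrm_nonneg[OF spd] by (simp_all add: p_def q_def r_def)
  have "(q - p)\<^sup>2 \<le> r\<^sup>2" using * by (intro power2_le_iff_abs_le[THEN iffD2]) auto
  then have "(q - p)\<^sup>2 * (2 * q + p) \<le> r\<^sup>2 * (3 * p + 2 * r)"
    using * by (intro mult_mono) auto
  then have "p * r\<^sup>2 / 2 + (q - p)\<^sup>2 * (2 * q + p) / 6 \<le> p * r\<^sup>2 / 2 + r\<^sup>2 * (3 * p + 2 * r) / 6"
    by simp
  also have "\<dots> = p * r\<^sup>2 + r ^ 3 / 3"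
    by (simp add: power2_eq_square power3_eq_cube field_simps)
  finally show ?thesis unfolding cubic_rem_eq by (fold p_def q_def r_def)
qed

text \<open>
  Uniform convexity of degree three of the cubed norm.
\<close>

lemma cubic_rem_ge: "nrm B s ^ 3 / 6 \<le> cubic_rem B a s"
proof -
  define p q r where "p = nrm B a" and "q = nrm B (a + s)" and "r = nrm B s"
  have *: "0 \<le> p" "0 \<le> q" "0 \<le> r" "r \<le> p + q"
    using nrm_three_points[where a = a and s = s] nrm_nonneg[OF spd] by (simp_all add: p_def q_def r_def)
  have "r ^ 3 \<le> 3 * (p * r\<^sup>2) + (q - p)\<^sup>2 * (2 * q + p)"
  \<comment> \<open>For a short step the quadratic term suffices; for a long one \<open>q - p \<ge> r - 2 * p\<close> is positive.\<close>
  proof (cases "r \<le> 3 * p")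
    case True
    then have "r * r\<^sup>2 \<le> (3 * p) * r\<^sup>2" by (intro mult_right_mono) auto
    moreover have "0 \<le> (q - p)\<^sup>2 * (2 * q + p)" using * by simp
    ultimately show ?thesis by (simp add: power3_eq_cube power2_eq_square)
  next
    case False
    have "(r - 2 * p)\<^sup>2 * (2 * r - p) \<le> (q - p)\<^sup>2 * (2 * q + p)"
      using False * by (intro mult_mono power_mono) auto
    moreover have "0 \<le> (r - 2 * p) ^ 3 + 4 * p ^ 3"
      using False * by simp
    ultimately show ?thesis by (simp add: power2_eq_square power3_eq_cube algebra_simps)
  qed
  then show ?thesis unfolding cubic_rem_eq by (fold p_def q_def r_def) simp
qed

text \<open>
  The two-sided estimate of the remainder gives the derivative everywhere at once, also at the centre,
  where the norm itself is not differentiable.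
\<close>

lemma prox_fun_has_derivative:
  "(prox_fun B \<alpha> x0 has_derivative blinfun_apply ((\<alpha> * nrm B (x - x0)) *\<^sub>R B (x - x0))) (at x)"
proof -
  obtain C where C: "C > 0" "\<And>x. nrm B x \<le> C * norm x" using nrm_le_norm[OF spd] by blast
  define a where "a = x - x0"
  have rem: "prox_fun B \<alpha> x0 y - prox_fun B \<alpha> x0 x - ((\<alpha> * nrm B a) *\<^sub>R B a) (y - x)
    = \<alpha> * cubic_rem B a (y - x)" for y
    by (simp add: prox_fun_def cubic_rem_def a_def blinfun.scaleR_left algebra_simps)
  have bound: "norm (\<alpha> * cubic_rem B a s) \<le>
      (\<bar>\<alpha>\<bar> * (nrm B a * C\<^sup>2 + C ^ 3 / 3)) * norm s * norm s" if "norm s < 1" for s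
  proof -
    have "nrm B s ^ 3 \<ge> 0" using nrm_nonneg[OF spd, of s] by simp
    then have "\<bar>cubic_rem B a s\<bar> \<le> nrm B a * (nrm B s)\<^sup>2 + nrm B s ^ 3 / 3"
      using cubic_rem_ge[of s a] cubic_rem_le[of a s] by linarith
    also have "\<dots> \<le> nrm B a * (C * norm s)\<^sup>2 + (C * norm s) ^ 3 / 3"
      using C nrm_nonneg[OF spd] by (intro add_mono mult_left_mono power_mono divide_right_mono) auto
    also have "\<dots> \<le> nrm B a * (C * norm s)\<^sup>2 + (C ^ 3 * (norm s * norm s)) / 3"
    proof -
      have "norm s * norm s * norm s \<le> norm s * norm s"
        using that by (intro mult_left_le) auto
      then have "C ^ 3 * norm s ^ 3 \<le> C ^ 3 * (norm s * norm s)"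
        using C by (intro mult_left_mono) (auto simp: power3_eq_cube)
      then show ?thesis by (simp add: power_mult_distrib)
    qed
    finally have "\<bar>\<alpha>\<bar> * \<bar>cubic_rem B a s\<bar> \<le>
        \<bar>\<alpha>\<bar> * (nrm B a * (C * norm s)\<^sup>2 + (C ^ 3 * (norm s * norm s)) / 3)"
      by (intro mult_left_mono) auto
    then show ?thesis by (simp add: abs_mult power2_eq_square algebra_simps)
  qed
  define M where "M = \<bar>\<alpha>\<bar> * (nrm B a * C\<^sup>2 + C ^ 3 / 3)"
  have M: "0 \<le> M" using C nrm_nonneg[OF spd] by (simp add: M_def)
  show ?thesis
    unfolding a_def[symmetric] has_derivative_within_alt
  proof (intro conjI allI impI)
    fix e :: real assume e: "0 < e"
    define r where "r = min 1 (e / (M + 1))"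
    have "norm (prox_fun B \<alpha> x0 y - prox_fun B \<alpha> x0 x - ((\<alpha> * nrm B a) *\<^sub>R B a) (y - x))
        \<le> e * norm (y - x)" if "norm (y - x) < r" for y
    proof -
      have "norm (y - x) * (M + 1) < e"
        using that M by (simp add: r_def pos_less_divide_eq)
      then have "M * norm (y - x) \<le> e" using norm_ge_zero[of "y - x"] unfolding distrib_left mult.commute[of M] by linarith
      then have "M * norm (y - x) * norm (y - x) \<le> e * norm (y - x)"
        by (intro mult_right_mono) auto
      moreover have "norm (y - x) < 1" using that by (simp add: r_def)
      ultimately show ?thesis unfolding rem using bound[of "y - x"] by (simp add: M_def)
    qed
    then show "\<exists>d>0. \<forall>y\<in>UNIV. norm (y - x) < d \<longrightarrow>
       norm (prox_fun B \<alpha> x0 y - prox_fun B \<alpha> x0 x - ((\<alpha> * nrm B a) *\<^sub>R B a) (y - x))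
        \<le> e * norm (y - x)"
      using e M by (intro exI[of _ r]) (auto simp: r_def)
  qed (rule blinfun.bounded_linear_right)
qed

lemma bregman_prox_fun: "bregman (prox_fun B \<alpha> x0) x y = \<alpha> * cubic_rem B (x - x0) (y - x)"
  unfolding bregman_def grad_eqI[OF prox_fun_has_derivative]
  by (simp add: prox_fun_def cubic_rem_def blinfun.scaleR_left algebra_simps)

lemma bregman_prox_fun_center: "bregman (prox_fun B \<alpha> x0) x0 y = \<alpha> * nrm B (y - x0) ^ 3 / 3"
  using nrm_eq_0_iff[OF spd, of 0] by (simp add: bregman_prox_fun cubic_rem_def)

lemma bregman_prox_fun_ge:
  assumes "0 \<le> \<alpha>"
  shows "\<alpha> * nrm B (y - x) ^ 3 / 6 \<le> bregman (prox_fun B \<alpha> x0) x y"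
  using mult_left_mono[OF cubic_rem_ge assms] by (simp add: bregman_prox_fun)

lemma bregman_prox_fun_nonneg:
  assumes "0 \<le> \<alpha>"
  shows "0 \<le> bregman (prox_fun B \<alpha> x0) x y"
  using bregman_prox_fun_ge[OF assms, of y x] assms nrm_nonneg[OF spd, of "y - x"]
  by (smt (verit) divide_nonneg_nonneg mult_nonneg_nonneg zero_le_power)

end

lemma bregman_convex_combination:
  "(1 - \<theta>) * bregman d a y + \<theta> * bregman d a z =
     bregman d a m + (1 - \<theta>) * bregman d m y + \<theta> * bregman d m z"
  if "m = y + \<theta> *\<^sub>R (z - y)"
proof -
  have "y - m = (- \<theta>) *\<^sub>R (z - y)" "z - m = (1 - \<theta>) *\<^sub>R (z - y)"
    "m - a = (y - a) + \<theta> *\<^sub>R (z - y)" "z - a = (y - a) + (z - y)"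
    by (simp_all add: that algebra_simps)
  then show ?thesis
    unfolding bregman_def
    by (simp only: blinfun.add_right blinfun.scaleR_right real_scaleR_def) (simp add: algebra_simps)
qed

text \<open>
  The cross term, a difference of gradients applied to \<open>z - y\<close>, is expressed by divergences through the
  three-point identity.
\<close>

lemma bregman_on_segment:
  "bregman d a (y + \<theta> *\<^sub>R (z - y)) =
     (1 - \<theta>) * bregman d a y + \<theta> * (bregman d a z - bregman d y z) + bregman d y (y + \<theta> *\<^sub>R (z - y))"
proof -
  have "y + \<theta> *\<^sub>R (z - y) - a = (y - a) + \<theta> *\<^sub>R (z - y)" "z - a = (y - a) + (z - y)"
    "y + \<theta> *\<^sub>R (z - y) - y = \<theta> *\<^sub>R (z - y)"
    by (simp_all add: algebra_simps)
  then show ?thesis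
    unfolding bregman_def
    by (simp only: blinfun.add_right blinfun.scaleR_right real_scaleR_def) (simp add: algebra_simps)
qed

text \<open>
  At an exact minimizer \<open>y\<close> the first-order condition gives the inequality without the two error terms.
  For an approximate one, comparison with \<open>w = y + \<tau> (z - y)\<close> and division by \<open>\<tau>\<close> do the same, because
  the divergence from \<open>y\<close> to \<open>w\<close> is of order \<open>\<tau>\<^sup>2\<close>.
\<close>

lemma inexact_prox_step:
  assumes spd: "spd B" and \<alpha>: "0 \<le> \<alpha>" and d: "d = prox_fun B \<alpha> x0"
    and g: "convex_on S g" and S: "y \<in> S" "z \<in> S" and \<tau>: "0 < \<tau>" "\<tau> \<le> 1"
    and opt: "\<And>w. w \<in> S \<Longrightarrow> g y + bregman d a y \<le> g w + bregman d a w + \<delta>"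
  shows "g y + bregman d a y + bregman d y z \<le>
     g z + bregman d a z + \<delta> / \<tau> + \<tau> * (bregman d x0 z + 12 * bregman d y z)"
proof -
  define w where "w = y + \<tau> *\<^sub>R (z - y)"
  define r where "r = nrm B (z - y)"
  define p where "p = nrm B (y - x0)"
  define D where "D = nrm B (z - x0)"
  have nonneg: "0 \<le> r" "0 \<le> p" "0 \<le> D" using nrm_nonneg[OF spd] by (simp_all add: r_def p_def D_def)
  have w: "w = (1 - \<tau>) *\<^sub>R y + \<tau> *\<^sub>R z" by (simp add: w_def algebra_simps)
  have "w \<in> S"
    using g S \<tau> unfolding w convex_on_def by (auto intro: convexD)
  moreover have "g w \<le> (1 - \<tau>) * g y + \<tau> * g z"
    using convex_onD[OF g, of \<tau> y z] S \<tau> by (simp add: w)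
  moreover have "bregman d a w = (1 - \<tau>) * bregman d a y + \<tau> * (bregman d a z - bregman d y z)
      + bregman d y w"
    unfolding w_def by (rule bregman_on_segment)
  ultimately have main: "\<tau> * (g y + bregman d a y + bregman d y z - g z - bregman d a z) \<le>
      \<delta> + bregman d y w"
    using opt[of w] by (simp add: algebra_simps)
  have "p \<le> D + r"
    using nrm_triangle[OF spd, of "z - x0" "y - z"] nrm_minus_commute[OF spd, of y z]
    by (simp add: p_def D_def r_def)
  then have "p * r\<^sup>2 \<le> (D + r) * r\<^sup>2" by (intro mult_right_mono) auto
  also have "\<dots> \<le> (2 * r ^ 3 + D ^ 3) / 3 + r ^ 3"
  proof -
    have "0 \<le> (r - D)\<^sup>2 * (2 * r + D)" using nonneg by simp
    then show ?thesis by (simp add: power2_eq_square power3_eq_cube algebra_simps)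
  qed
  finally have pr: "p * r\<^sup>2 + r ^ 3 / 3 \<le> D ^ 3 / 3 + 2 * r ^ 3" by argo
  have "bregman d y w = \<alpha> * cubic_rem B (y - x0) (\<tau> *\<^sub>R (z - y))"
    unfolding d bregman_prox_fun[OF spd] by (simp add: w_def)
  also have "\<dots> \<le> \<alpha> * (p * (\<tau> * r)\<^sup>2 + (\<tau> * r) ^ 3 / 3)"
    using mult_left_mono[OF cubic_rem_le[OF spd, of "y - x0" "\<tau> *\<^sub>R (z - y)"] \<alpha>] \<tau>
    by (simp add: nrm_scaleR[OF spd] p_def r_def)
  also have "\<dots> \<le> \<alpha> * (\<tau>\<^sup>2 * (p * r\<^sup>2 + r ^ 3 / 3))"
  proof -
    have "\<tau> ^ 3 * r ^ 3 \<le> \<tau>\<^sup>2 * r ^ 3"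
      using \<tau> nonneg by (intro mult_right_mono power_decreasing) auto
    then show ?thesis using \<alpha> by (intro mult_left_mono) (auto simp: power_mult_distrib algebra_simps)
  qed
  also have "\<dots> \<le> \<alpha> * (\<tau>\<^sup>2 * (D ^ 3 / 3 + 2 * r ^ 3))"
    using pr \<alpha> by (intro mult_left_mono) auto
  also have "\<dots> = \<tau>\<^sup>2 * (bregman d x0 z + 12 * (\<alpha> * r ^ 3 / 6))"
    unfolding d bregman_prox_fun_center[OF spd] by (simp add: D_def algebra_simps)
  also have "\<dots> \<le> \<tau>\<^sup>2 * (bregman d x0 z + 12 * bregman d y z)"
    using bregman_prox_fun_ge[OF spd \<alpha>, of z y x0]
    by (intro mult_left_mono) (auto simp: r_def d)
  finally have "bregman d y w \<le> \<tau>\<^sup>2 * (bregman d x0 z + 12 * bregman d y z)" .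
  then have "\<tau> * (g y + bregman d a y + bregman d y z - g z - bregman d a z) \<le>
      \<tau> * (\<delta> / \<tau> + \<tau> * (bregman d x0 z + 12 * bregman d y z))"
    using main \<tau> by (simp add: distrib_left power2_eq_square mult.assoc)
  then have "g y + bregman d a y + bregman d y z - g z - bregman d a z \<le>
      \<delta> / \<tau> + \<tau> * (bregman d x0 z + 12 * bregman d y z)"
    using \<tau> by (simp only: mult_le_cancel_left_pos)
  then show ?thesis by simp
qed

text \<open>
  The bound for the new point is taken at a quarter of the way from \<open>z\<close> to \<open>y\<close>.  The cube of the distance
  between \<open>z\<close> and \<open>y\<close> that appears there is controlled by the gap at \<open>z\<close>, since the value at the midpoint
  falls below the mean of the end values by a multiple of it.  The comparison point \<open>y\<close> is arbitrary, so
  a minimizer need not exist.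
\<close>

lemma cubic_step_contraction:
  assumes spd: "spd B" and \<alpha>: "0 \<le> \<alpha>" and d: "d = prox_fun B \<alpha> x0"
    and g: "convex_on S g" and S: "z \<in> S" "y \<in> S"
    and H: "\<And>w. H w = g w + bregman d a w"
    and step: "\<And>w. w \<in> S \<Longrightarrow> H z' \<le> H w + \<alpha> / 3 * nrm B (w - z) ^ 3"
    and gap: "\<And>w. w \<in> S \<Longrightarrow> H z \<le> H w + \<Delta>"
  shows "H z' \<le> H y + 7 / 8 * \<Delta>"
proof -
  define r where "r = nrm B (y - z)"
  have seg: "z + \<theta> *\<^sub>R (y - z) \<in> S"
    "H (z + \<theta> *\<^sub>R (y - z)) + (1 - \<theta>) * bregman d (z + \<theta> *\<^sub>R (y - z)) z
      + \<theta> * bregman d (z + \<theta> *\<^sub>R (y - z)) y \<le> (1 - \<theta>) * H z + \<theta> * H y"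
    if \<theta>: "0 \<le> \<theta>" "\<theta> \<le> 1" for \<theta>
  proof -
    have w: "z + \<theta> *\<^sub>R (y - z) = (1 - \<theta>) *\<^sub>R z + \<theta> *\<^sub>R y" by (simp add: algebra_simps)
    show "z + \<theta> *\<^sub>R (y - z) \<in> S"
      using g S \<theta> unfolding w convex_on_def by (auto intro: convexD)
    have "g (z + \<theta> *\<^sub>R (y - z)) \<le> (1 - \<theta>) * g z + \<theta> * g y"
      unfolding w using convex_onD[OF g, of \<theta> z y] S \<theta> by simp
    then show "H (z + \<theta> *\<^sub>R (y - z)) + (1 - \<theta>) * bregman d (z + \<theta> *\<^sub>R (y - z)) z
      + \<theta> * bregman d (z + \<theta> *\<^sub>R (y - z)) y \<le> (1 - \<theta>) * H z + \<theta> * H y"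
      using bregman_convex_combination[of "z + \<theta> *\<^sub>R (y - z)" z \<theta> y d a]
      by (simp add: H distrib_left)
  qed
  define m where "m = z + (1 / 2) *\<^sub>R (y - z)"
  have m: "z - m = (- (1 / 2)) *\<^sub>R (y - z)" "y - m = (1 / 2) *\<^sub>R (y - z)"
    by (simp_all add: m_def algebra_simps flip: scaleR_add_left)
  have "\<alpha> * r ^ 3 / 48 \<le> bregman d m z" "\<alpha> * r ^ 3 / 48 \<le> bregman d m y"
    using bregman_prox_fun_ge[OF spd \<alpha>, of z m x0] bregman_prox_fun_ge[OF spd \<alpha>, of y m x0]
    unfolding m d nrm_scaleR[OF spd] by (simp_all add: r_def power3_eq_cube)
  then have "H m + \<alpha> * r ^ 3 / 48 \<le> (H z + H y) / 2"
    using seg(2)[of "1 / 2"] by (simp add: m_def)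
  moreover have "H z \<le> H m + \<Delta>" using gap seg(1)[of "1 / 2"] by (simp add: m_def)
  ultimately have r: "\<alpha> * r ^ 3 \<le> 24 * (H y - H z) + 48 * \<Delta>" by simp
  define w where "w = z + (1 / 4) *\<^sub>R (y - z)"
  have "H w \<le> 3 / 4 * H z + 1 / 4 * H y"
    using seg(2)[of "1 / 4"] bregman_prox_fun_nonneg[OF spd \<alpha>, of x0 w z]
      bregman_prox_fun_nonneg[OF spd \<alpha>, of x0 w y]
    by (simp add: w_def d)
  moreover have "H z' \<le> H w + \<alpha> / 3 * (1 / 4 * r) ^ 3"
    using step[of w] seg(1)[of "1 / 4"] by (simp add: w_def nrm_scaleR[OF spd] r_def)
  ultimately have "H z' \<le> 3 / 4 * H z + 1 / 4 * H y + \<alpha> * r ^ 3 / 192"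
    by (simp add: power3_eq_cube)
  then show ?thesis using r gap[OF S(2)] by simp
qed


section \<open>Second-order Taylor models\<close>

text \<open>
  The factor \<open>\<sigma>\<close> treats both signs of the error.  Along the segment from \<open>x\<close> to \<open>y\<close>, the difference
  \<open>w\<close> of the cubic bound and the signed error vanishes to second order at \<open>0\<close> and has a nonnegative second
  derivative.
\<close>

lemma hess_lipschitz_Taylor_upper:
  fixes \<sigma> :: real
  assumes spd: "spd B" and U: "open U" "convex U" and g: "twice_cont_diff U g"
    and lip: "hess_lipschitz B U g l" and x: "x \<in> U" and y: "y \<in> U" and \<sigma>: "\<bar>\<sigma>\<bar> = 1"
  shows "\<sigma> * (g y - (g x + grad g x (y - x) + 1 / 2 * hess g x (y - x) (y - x)))
    \<le> l / 6 * nrm B (y - x) ^ 3"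
proof -
  define h where "h = y - x"
  define r where "r = nrm B h"
  define p where "p = (\<lambda>t. x + t *\<^sub>R h)"
  have p: "p t \<in> U" if "0 \<le> t" "t \<le> 1" for t
  proof -
    have "p t = (1 - t) *\<^sub>R x + t *\<^sub>R y" by (simp add: p_def h_def algebra_simps)
    then show ?thesis using U x y that by (auto intro: convexD)
  qed
  have p_deriv: "(p has_derivative (\<lambda>s. s *\<^sub>R h)) (at t)" for t
    unfolding p_def by (auto intro!: derivative_eq_intros)
  have g1: "((\<lambda>t. g (p t)) has_real_derivative grad g (p t) h) (at t)" if "0 \<le> t" "t \<le> 1" for t
  proof -
    have "(g has_derivative blinfun_apply (grad g (p t))) (at (p t))"
      using g p[OF that] by (intro has_derivative_grad) (auto simp: twice_cont_diff_def)
    from has_derivative_compose[OF p_deriv this]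
    show ?thesis by (simp add: has_field_derivative_def blinfun.scaleR_right mult_commute_abs)
  qed
  have g2: "((\<lambda>t. grad g (p t) h) has_real_derivative hess g (p t) h h) (at t)"
    if "0 \<le> t" "t \<le> 1" for t
  proof -
    have "(grad g has_derivative blinfun_apply (hess g (p t))) (at (p t))"
      unfolding hess_def using g p[OF that]
      by (intro has_derivative_grad) (auto simp: twice_cont_diff_def)
    from has_derivative_compose[OF p_deriv this]
    have "((\<lambda>t. grad g (p t)) has_derivative (\<lambda>s. s *\<^sub>R hess g (p t) h)) (at t)"
      by (simp add: blinfun.scaleR_right)
    then have "((\<lambda>t. grad g (p t) h) has_derivative (\<lambda>s. (s *\<^sub>R hess g (p t) h) h)) (at t)"
      by (rule bounded_linear.has_derivative[OF blinfun.bounded_linear_left])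
    then show ?thesis by (simp add: has_field_derivative_def blinfun.scaleR_left mult_commute_abs)
  qed
  have g3: "\<sigma> * (hess g (p t) h h - hess g x h h) \<le> l * t * r ^ 3" if "0 \<le> t" "t \<le> 1" for t
  proof -
    have "(hess g a - hess g b) h h \<le> l * nrm B (a - b) * r\<^sup>2" if "a \<in> U" "b \<in> U" for a b
    proof -
      have "(hess g a - hess g b) h h \<le> op_nrm B (hess g a - hess g b) * r\<^sup>2"
        unfolding r_def by (rule blinfun_le_op_nrm[OF spd])
      also have "\<dots> \<le> l * nrm B (a - b) * r\<^sup>2"
        using lip that by (intro mult_right_mono) (auto simp: hess_lipschitz_def)
      finally show ?thesis .
    qed
    note this[OF p[OF that] x] this[OF x p[OF that]]
    moreover have "nrm B (p t - x) = t * r" "nrm B (x - p t) = t * r"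
      using that nrm_minus_commute[OF spd, of x "p t"]
      by (simp_all add: p_def nrm_scaleR[OF spd] r_def)
    moreover have "\<sigma> = 1 \<or> \<sigma> = -1" using \<sigma> by linarith
    ultimately show ?thesis
      by (auto simp: blinfun.diff_left power2_eq_square power3_eq_cube mult_ac)
  qed
  define w1 where "w1 = (\<lambda>t. l * r ^ 3 * (t\<^sup>2 / 2) - \<sigma> * (grad g (p t) h - grad g x h - hess g x h h * t))"
  define w where "w = (\<lambda>t. l * r ^ 3 * (t ^ 3 / 6) - \<sigma> * (g (p t) - g x - grad g x h * t - hess g x h h * (t\<^sup>2 / 2)))"
  have w1: "(w1 has_real_derivative (l * r ^ 3 * t - \<sigma> * (hess g (p t) h h - hess g x h h))) (at t)"
    if "0 \<le> t" "t \<le> 1" for t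
    unfolding w1_def using g2[OF that] by (auto intro!: derivative_eq_intros)
  have w: "(w has_real_derivative w1 t) (at t)" if "0 \<le> t" "t \<le> 1" for t
    unfolding w_def w1_def using g1[OF that]
    by (auto intro!: derivative_eq_intros simp: power2_eq_square mult_ac)
  have "0 \<le> w1 t" if "0 \<le> t" "t \<le> 1" for t
  proof -
    have "w1 0 \<le> w1 t"
      using that w1 g3 by (intro DERIV_nonneg_imp_nondecreasing[of 0 t w1])
        (fastforce simp: mult_ac)+
    then show ?thesis by (simp add: w1_def p_def)
  qed
  then have "w 0 \<le> w 1"
    using w by (intro DERIV_nonneg_imp_nondecreasing[of 0 1 w]) auto
  then show ?thesis by (simp add: w_def p_def h_def r_def algebra_simps)
qed

lemma hess_lipschitz_Taylor:
  assumes "spd B" "open U" "convex U" "twice_cont_diff U g" "hess_lipschitz B U g l" "x \<in> U" "y \<in> U"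
  shows "\<bar>g y - (g x + grad g x (y - x) + 1 / 2 * hess g x (y - x) (y - x))\<bar>
    \<le> l / 6 * nrm B (y - x) ^ 3"
  using hess_lipschitz_Taylor_upper[OF assms, of 1] hess_lipschitz_Taylor_upper[OF assms, of "-1"]
  unfolding abs_le_iff by simp

lemma contract_has_derivative: "(contract k c has_derivative (\<lambda>h. gam k *\<^sub>R h)) (at x)"
  unfolding contract_def by (auto intro!: derivative_eq_intros)

lemma contract_diff: "contract k c x - contract k c z = gam k *\<^sub>R (x - z)"
  by (simp add: contract_def algebra_simps)

lemma contract_grad_has_derivative:
  assumes "g differentiable at (contract k c x)"
  shows "((\<lambda>z. g (contract k c z)) has_derivative
    blinfun_apply (gam k *\<^sub>R grad g (contract k c x))) (at x)"
  using has_derivative_compose[OF contract_has_derivative has_derivative_grad[OF assms]]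
  by (simp add: blinfun.scaleR_right scaleR_blinfun.rep_eq)

lemmas grad_contract = grad_eqI[OF contract_grad_has_derivative]

text \<open>
  The formula for the gradient holds on the preimage of \<open>U\<close>, an open set, so it may be differentiated
  again.
\<close>

lemma hess_contract:
  assumes U: "open U" and x: "contract k c x \<in> U" and g: "twice_cont_diff U g"
  shows "hess (\<lambda>z. g (contract k c z)) x = (gam k)\<^sup>2 *\<^sub>R hess g (contract k c x)"
proof -
  have cont: "continuous_on UNIV (contract k c)"
    unfolding contract_def by (intro continuous_intros)
  have "((\<lambda>z. gam k *\<^sub>R grad g (contract k c z)) has_derivative
      (\<lambda>h. gam k *\<^sub>R (gam k *\<^sub>R grad (grad g) (contract k c x)) h)) (at x)"
    using g x by (intro has_derivative_scaleR_right contract_grad_has_derivative)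
      (auto simp: twice_cont_diff_def)
  then have "(grad (\<lambda>z. g (contract k c z)) has_derivative
      (\<lambda>h. gam k *\<^sub>R (gam k *\<^sub>R grad (grad g) (contract k c x)) h)) (at x)"
    using g x open_vimage[OF U cont]
    by (elim has_derivative_transform_within_open[where s = "contract k c -` U"])
      (auto simp: twice_cont_diff_def grad_contract)
  then show ?thesis
    unfolding hess_def by (intro grad_eqI) (simp add: scaleR_blinfun.rep_eq power2_eq_square)
qed

text \<open>
  Taylor models commute with the affine substitution of the subproblem, so the model error can be
  estimated for \<open>f\<close> itself.
\<close>

lemma Omega2_f_bar:
  assumes "inner_map B U f L" and "contract k c z \<in> U"
  shows "Omega2 (f_bar f k c) z x = Omega2 f (contract k c z) (contract k c x)"
proof -
  have f: "open U" "twice_cont_diff U (\<lambda>x. f x $ i)" for i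
    using assms(1) by (auto simp: inner_map_def)
  have "(\<lambda>x. f x $ i) differentiable at (contract k c z)" for i
    using f(2)[of i] assms(2) by (auto simp: twice_cont_diff_def)
  note grad_contract[OF this] hess_contract[OF f(1) assms(2) f(2)]
  then show ?thesis
    unfolding Omega2_def f_bar_def contract_diff
    by (simp add: blinfun.scaleR_left blinfun.scaleR_right power2_eq_square mult.assoc)
qed


section \<open>The coefficients\<close>

lemma Acoef_Suc_pos: "0 < Acoef (Suc k)" and Acoef_nonneg: "0 \<le> Acoef k"
  by (simp_all add: Acoef_def)

lemma Acoef_gam: "Acoef (Suc k) * gam k = Acoef (Suc k) - Acoef k"
  "Acoef (Suc k) * (1 - gam k) = Acoef k"
  using Acoef_Suc_pos[of k] by (simp_all add: gam_def field_simps)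

lemma gam_bounds: "0 < gam k" "gam k \<le> 1"
proof -
  have "Acoef k < Acoef (Suc k)"
    unfolding Acoef_def by (intro power_strict_mono) auto
  then show "0 < gam k" "gam k \<le> 1"
    using Acoef_Suc_pos[of k] Acoef_nonneg[of k] by (simp_all add: gam_def)
qed

text \<open>
  The reason for the cubic growth of the coefficients: the increment \<open>a\<close> is at most
  \<open>(k + 1)\<^sup>2 / 9\<close>, and the cube of this number is exactly the square of \<open>Acoef (Suc k)\<close>.
\<close>

lemma Acoef_gam_cube_le_1: "Acoef (Suc k) * gam k ^ 3 \<le> 1"
proof -
  define a where "a = Acoef (Suc k) - Acoef k"
  define t where "t = real k"
  have t: "0 \<le> t" by (simp add: t_def)
  have a_eq: "a = (3 * t\<^sup>2 + 3 * t + 1) / 27"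
    by (simp add: a_def Acoef_def t_def power2_eq_square power3_eq_cube field_simps)
  have "a \<le> (t + 1)\<^sup>2 / 9" using t by (simp add: a_eq power2_eq_square field_simps)
  moreover have "0 \<le> a" using t by (simp add: a_eq)
  ultimately have "a ^ 3 \<le> ((t + 1)\<^sup>2 / 9) ^ 3" by (rule power_mono)
  also have "\<dots> = (Acoef (Suc k))\<^sup>2"
    by (simp add: Acoef_def t_def power2_eq_square power3_eq_cube field_simps)
  finally have "a ^ 3 / (Acoef (Suc k))\<^sup>2 \<le> 1"
    using Acoef_Suc_pos[of k] by simp
  moreover have "Acoef (Suc k) * gam k ^ 3 = a ^ 3 / (Acoef (Suc k))\<^sup>2"
    using Acoef_Suc_pos[of k]
    by (simp add: gam_def a_def power_divide power2_eq_square power3_eq_cube)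
  ultimately show ?thesis by simp
qed

section \<open>The composite problem\<close>

text \<open>
  Real comparisons replace the extended infimum.  The two sides agree also when the infimum is
  \<open>-\<infinity>\<close>: then both fail.
\<close>

lemma accurate_min_iff:
  assumes "\<And>w. w \<in> S \<Longrightarrow> h w = ereal (H w)"
  shows "accurate_min S h \<delta> y \<longleftrightarrow> y \<in> S \<and> (\<forall>w\<in>S. H y \<le> H w + \<delta>)"
proof (cases "y \<in> S")
  case True
  let ?m = "INF w\<in>S. h w"
  have h: "h y = ereal (H y)" by (rule assms[OF True])
  have "h y - ?m \<le> ereal \<delta> \<longleftrightarrow> ereal (H y - \<delta>) \<le> ?m"
    using INF_lower[OF True, of h] unfolding h by (cases ?m) auto
  also have "\<dots> \<longleftrightarrow> (\<forall>w\<in>S. H y \<le> H w + \<delta>)"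
    by (auto simp: le_INF_iff assms)
  finally show ?thesis using True by (simp add: accurate_min_def)
qed (simp add: accurate_min_def)

locale composite_problem =
  fixes B :: "'e::euclidean_space \<Rightarrow> ('e \<Rightarrow>\<^sub>L real)"
    and F :: "'e \<Rightarrow> real ^ 'm \<Rightarrow> ereal" and U :: "'e set" and f :: "'e \<Rightarrow> real ^ 'm"
    and L :: "real ^ 'm" and \<alpha> :: real
  assumes spd: "spd B" and outer: "outer_fun F" and inner: "inner_map B U f L"
    and subhom: "subhomogeneous_on (dom_phi F U f) F"
    and sup: "F_sup (dom_phi F U f) F L = ereal \<alpha>"
    and nonempty: "dom_phi F U f \<noteq> {}"
begin

abbreviation "S \<equiv> dom_phi F U f"

text \<open>
  The objective \<open>phi F U f\<close> as a real function; meaningful on \<open>S\<close> only.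
\<close>

definition psi :: "'e \<Rightarrow> real" where
  "psi x = real_of_ereal (F x (f x))"

text \<open>
  Likewise the real form of the objective \<open>h_obj F U f d k c v\<close> of the subproblem.
\<close>

definition prox_obj :: "('e \<Rightarrow> real) \<Rightarrow> nat \<Rightarrow> 'e \<Rightarrow> 'e \<Rightarrow> 'e \<Rightarrow> real" where
  "prox_obj d k c v x = Acoef (Suc k) * psi (contract k c x) + bregman d v x"

lemma F_not_MInf: "F x u \<noteq> -\<infinity>"
  using outer unfolding outer_fun_def by blast

lemma F_eq_psi: "x \<in> S \<Longrightarrow> F x (f x) = ereal (psi x)"
  using F_not_MInf[of x "f x"] by (cases "F x (f x)") (auto simp: dom_phi_def psi_def)

lemma phi_eq_psi: "x \<in> S \<Longrightarrow> phi F U f x = ereal (psi x)"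
  using F_eq_psi[of x] by (simp add: phi_def dom_phi_def)

lemma F_mono_finite:
  assumes "F x u0 < \<infinity>" and "\<And>i. u $ i \<le> v $ i"
  shows "F x u \<le> F x v"
proof -
  have "{u. F x u < \<infinity>} \<noteq> {}" using assms(1) by blast
  then show ?thesis using outer assms(2) unfolding outer_fun_def by blast
qed

lemma F_mono:
  assumes "x \<in> S" and "\<And>i. u $ i \<le> v $ i"
  shows "F x u \<le> F x v"
  using F_mono_finite[of x "f x"] assms by (auto simp: dom_phi_def)

text \<open>
  Joint convexity of \<open>F\<close> bounds \<open>F\<close> at the combination of the values of \<open>f\<close>; convexity of \<open>f\<close> and
  monotonicity of \<open>F\<close> pass to the value of \<open>f\<close> at the combination, which also shows that the domain is
  convex.
\<close>

lemma convex_on_psi: "convex_on S psi"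
proof -
  have comb: "(1 - t) *\<^sub>R x + t *\<^sub>R y \<in> S \<and>
      psi ((1 - t) *\<^sub>R x + t *\<^sub>R y) \<le> (1 - t) * psi x + t * psi y"
    if t: "0 \<le> t" "t \<le> 1" and x: "x \<in> S" and y: "y \<in> S" for x y t
  proof -
    define w where "w = (1 - t) *\<^sub>R x + t *\<^sub>R y"
    define u where "u = (1 - t) *\<^sub>R f x + t *\<^sub>R f y"
    have xy: "x \<in> U" "y \<in> U" using x y by (auto simp: dom_phi_def)
    have w: "w \<in> U"
      using inner xy t by (auto simp: inner_map_def w_def intro: convexD)
    have fu: "f w $ i \<le> u $ i" for i
    proof -
      have "convex_on U (\<lambda>x. f x $ i)" using inner by (auto simp: inner_map_def)
      from convex_onD[OF this t xy] show ?thesis by (simp add: w_def u_def)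
    qed
    let ?E = "{(q, s). (case q of (x, u) \<Rightarrow> F x u) \<le> ereal s}"
    have "convex ?E" using outer by (simp add: outer_fun_def closed_convex_def)
    moreover have "((x, f x), psi x) \<in> ?E" "((y, f y), psi y) \<in> ?E"
      using F_eq_psi x y by auto
    ultimately have "(1 - t) *\<^sub>R ((x, f x), psi x) + t *\<^sub>R ((y, f y), psi y) \<in> ?E"
      using t by (intro convexD) auto
    then have Fu: "F w u \<le> ereal ((1 - t) * psi x + t * psi y)"
      by (simp add: w_def u_def)
    then have "F w u < \<infinity>" by (rule order.strict_trans1) simp
    from F_mono_finite[OF this fu] Fu
    have Fw: "F w (f w) \<le> ereal ((1 - t) * psi x + t * psi y)" by (rule order_trans)
    then have "F w (f w) < \<infinity>" by (rule order.strict_trans1) simp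
    then have "w \<in> S" using w by (simp add: dom_phi_def)
    then show ?thesis using Fw F_eq_psi[of w] by (simp add: w_def)
  qed
  have "convex S" unfolding convex_alt using comb by blast
  then show ?thesis using comb by (intro convex_onI) auto
qed

lemma convex_S: "convex S"
  using convex_on_psi by (simp add: convex_on_def)

lemma contract_in: "c \<in> S \<Longrightarrow> x \<in> S \<Longrightarrow> contract k c x \<in> S"
  using gam_bounds[of k] convex_S unfolding contract_def by (intro convexD) auto

lemma convex_on_contracted_psi:
  assumes "c \<in> S"
  shows "convex_on S (\<lambda>x. Acoef (Suc k) * psi (contract k c x))"
proof (intro convex_onI convex_S)
  fix t :: real and x y assume t: "0 < t" "t < 1" and xy: "x \<in> S" "y \<in> S"
  have "contract k c ((1 - t) *\<^sub>R x + t *\<^sub>R y) =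
      (1 - t) *\<^sub>R contract k c x + t *\<^sub>R contract k c y"
    by (simp add: contract_def algebra_simps)
  then have "psi (contract k c ((1 - t) *\<^sub>R x + t *\<^sub>R y)) \<le>
      (1 - t) * psi (contract k c x) + t * psi (contract k c y)"
    using convex_onD[OF convex_on_psi, of t "contract k c x" "contract k c y"] t xy assms contract_in
    by simp
  from mult_left_mono[OF this, of "Acoef (Suc k)"] Acoef_nonneg
  show "Acoef (Suc k) * psi (contract k c ((1 - t) *\<^sub>R x + t *\<^sub>R y)) \<le>
      (1 - t) * (Acoef (Suc k) * psi (contract k c x)) + t * (Acoef (Suc k) * psi (contract k c y))"
    by (simp add: algebra_simps)
qed

lemma Acoef_psi_contract_le:
  assumes "c \<in> S" "x \<in> S"
  shows "Acoef (Suc k) * psi (contract k c x) \<le>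
    (Acoef (Suc k) - Acoef k) * psi x + Acoef k * psi c"
proof -
  have "psi (contract k c x) \<le> gam k * psi x + (1 - gam k) * psi c"
    using convex_onD[OF convex_on_psi, of "gam k" c x] gam_bounds[of k] assms
    by (simp add: contract_def add.commute)
  from mult_left_mono[OF this Acoef_nonneg[of "Suc k"]]
  show ?thesis by (simp only: distrib_left mult.assoc[symmetric] Acoef_gam)
qed

lemma h_obj_eq:
  assumes "c \<in> S" "x \<in> S"
  shows "h_obj F U f d k c v x = ereal (prox_obj d k c v x)"
  using phi_eq_psi[OF contract_in[OF assms]] by (simp add: h_obj_def prox_obj_def)

lemma accurate_min_h_obj_iff:
  assumes "c \<in> S"
  shows "accurate_min S (h_obj F U f d k c v) \<delta> y \<longleftrightarrow>
    y \<in> S \<and> (\<forall>w\<in>S. prox_obj d k c v y \<le> prox_obj d k c v w + \<delta>)"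
  by (rule accurate_min_iff) (rule h_obj_eq[OF assms])

text \<open>
  Nonnegativity rests on subhomogeneity in the direction \<open>0\<close>, which forces \<open>F x 0 \<ge> 0\<close>, and on the
  monotonicity of \<open>F\<close>, as Lipschitz constants are nonnegative.
\<close>

lemma F_L_real:
  assumes "x \<in> S"
  obtains l where "F x L = ereal l" "0 \<le> l" "l \<le> \<alpha>"
proof -
  have "F x (f x + 1 *\<^sub>R 0) \<le> F x (f x) + ereal 1 * F x 0"
    using subhom assms unfolding subhomogeneous_on_def by (meson zero_le_one)
  then have "0 \<le> F x 0"
    unfolding F_eq_psi[OF assms] by (cases "F x 0") (simp_all add: F_eq_psi[OF assms])
  also have "\<dots> \<le> F x L"
    using inner assms by (intro F_mono) (auto simp: inner_map_def hess_lipschitz_def)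
  finally have "0 \<le> F x L" .
  moreover have "F x L \<le> ereal \<alpha>"
    unfolding sup[symmetric] F_sup_def using assms by (rule SUP_upper)
  ultimately show ?thesis using that by (cases "F x L") auto
qed

lemma alpha_nonneg: "0 \<le> \<alpha>"
  using nonempty F_L_real by (metis all_not_in_conv order_trans)

text \<open>
  The componentwise Taylor error is a multiple of \<open>L\<close>; monotonicity carries it into \<open>F\<close> and
  subhomogeneity takes it out again.
\<close>

lemma F_Omega2_real:
  assumes x: "x \<in> S" and z: "z \<in> S" and l: "F x L = ereal l"
  shows "\<exists>a. F x (Omega2 f z x) = ereal a \<and> \<bar>a - psi x\<bar> \<le> nrm B (x - z) ^ 3 / 6 * l"
proof -
  define t where "t = nrm B (x - z) ^ 3 / 6"
  have t: "0 \<le> t" using nrm_nonneg[OF spd] by (simp add: t_def)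
  have taylor: "\<bar>f x $ i - Omega2 f z x $ i\<bar> \<le> t * L $ i" for i
    using hess_lipschitz_Taylor[OF spd, of U "\<lambda>x. f x $ i" "L $ i" z x] inner x z
    by (simp add: inner_map_def Omega2_def dom_phi_def t_def mult.commute)
  have sub: "F x (u + t *\<^sub>R L) \<le> F x u + ereal (t * l)" for u
  proof -
    have "F x (u + t *\<^sub>R L) \<le> F x u + ereal t * F x L"
      using subhom x t unfolding subhomogeneous_on_def by blast
    then show ?thesis by (simp add: l)
  qed
  have up: "F x (Omega2 f z x) \<le> F x (f x + t *\<^sub>R L)"
    using x taylor by (intro F_mono) (auto simp: abs_le_iff algebra_simps)
  have lo: "F x (f x) \<le> F x (Omega2 f z x + t *\<^sub>R L)"
    using x taylor by (intro F_mono) (auto simp: abs_le_iff algebra_simps)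
  show ?thesis
    using order_trans[OF up sub] order_trans[OF lo sub] F_not_MInf[of x "Omega2 f z x"]
    unfolding F_eq_psi[OF x] t_def[symmetric]
    by (cases "F x (Omega2 f z x)") auto
qed

lemma newton_const_real:
  assumes c: "c \<in> S"
  obtains M where "newton_const F U f L k c = ereal M" "0 \<le> M" "M \<le> \<alpha>"
    "\<forall>x\<in>S. \<forall>l. F (contract k c x) L = ereal l \<longrightarrow> Acoef (Suc k) * gam k ^ 3 * l \<le> M"
proof -
  let ?A = "Acoef (Suc k)"
  let ?N = "newton_const F U f L k c"
  have A: "0 \<le> ?A * gam k ^ 3" using Acoef_nonneg gam_bounds[of k] by simp
  have upper: "ereal (?A * gam k ^ 3 * l) \<le> ?N" if "x \<in> S" "F (contract k c x) L = ereal l" for x l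
  proof -
    have "ereal ?A * (ereal (gam k ^ 3) * F (contract k c x) L) \<le> ?N"
      unfolding newton_const_def F_sup_def using that(1) by (rule SUP_upper)
    then show ?thesis by (simp add: that(2) mult.assoc)
  qed
  have "?N \<le> ereal \<alpha>"
    unfolding newton_const_def F_sup_def
  proof (rule SUP_least)
    fix x assume "x \<in> S"
    then obtain l where l: "F (contract k c x) L = ereal l" "0 \<le> l" "l \<le> \<alpha>"
      using F_L_real contract_in[OF c] by metis
    have "(?A * gam k ^ 3) * l \<le> 1 * \<alpha>"
      using Acoef_gam_cube_le_1[of k] A l by (intro mult_mono) auto
    then show "ereal ?A * (ereal (gam k ^ 3) * F (contract k c x) L) \<le> ereal \<alpha>"
      by (simp add: l(1) mult.assoc)
  qed
  moreover have "0 \<le> ?N"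
  proof -
    obtain l where l: "F (contract k c c) L = ereal l" "0 \<le> l"
      using F_L_real contract_in[OF c c] by metis
    have "0 \<le> ereal (?A * gam k ^ 3 * l)" using A l(2) by simp
    then show ?thesis using upper[OF c l(1)] by (rule order_trans)
  qed
  ultimately obtain M where "?N = ereal M" "0 \<le> M" "M \<le> \<alpha>" by (cases ?N) auto
  then show ?thesis using that upper by simp
qed

text \<open>
  The regularized model lies above the objective of the subproblem and exceeds it by at most \<open>M / 3\<close>
  times the cubed distance, where \<open>M \<le> \<alpha>\<close> is the regularization parameter;
  minimizing the model therefore beats every point up to this excess.
\<close>

lemma newton_step:
  assumes c: "c \<in> S" and z: "z \<in> S"
    and min: "is_arg_min
        (\<lambda>x. F_bar F d k c v x (Omega2 (f_bar f k c) z x)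
              + newton_const F U f L k c / 6 * ereal (nrm B (x - z) ^ 3))
        (\<lambda>x. x \<in> S) z'"
  shows "z' \<in> S" and "w \<in> S \<Longrightarrow>
    prox_obj d k c v z' \<le> prox_obj d k c v w + \<alpha> / 3 * nrm B (w - z) ^ 3"
proof -
  show z': "z' \<in> S" using min by (simp add: is_arg_min_def)
  define q where "q = (\<lambda>x. F_bar F d k c v x (Omega2 (f_bar f k c) z x)
              + newton_const F U f L k c / 6 * ereal (nrm B (x - z) ^ 3))"
  have min_q: "is_arg_min q (\<lambda>x. x \<in> S) z'" using min by (simp only: q_def)
  obtain M where M: "newton_const F U f L k c = ereal M" "0 \<le> M" "M \<le> \<alpha>"
    "\<forall>x\<in>S. \<forall>l. F (contract k c x) L = ereal l \<longrightarrow> Acoef (Suc k) * gam k ^ 3 * l \<le> M"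
    using newton_const_real[OF c, of k] by metis
  have model: "ereal (prox_obj d k c v x) \<le> q x \<and>
      q x \<le> ereal (prox_obj d k c v x + M / 3 * nrm B (x - z) ^ 3)" if x: "x \<in> S" for x
  proof -
    define A where "A = Acoef (Suc k)"
    define r where "r = nrm B (x - z) ^ 3"
    have r: "0 \<le> r" using nrm_nonneg[OF spd] by (simp add: r_def)
    obtain l where l: "F (contract k c x) L = ereal l"
      using F_L_real contract_in[OF c x] by metis
    have cube: "nrm B (contract k c x - contract k c z) ^ 3 = gam k ^ 3 * r"
      using gam_bounds[of k] by (simp add: contract_diff nrm_scaleR[OF spd] r_def power_mult_distrib)
    have "\<exists>a. F (contract k c x) (Omega2 f (contract k c z) (contract k c x)) = ereal a \<and>
        \<bar>a - psi (contract k c x)\<bar> \<le> gam k ^ 3 * r / 6 * l"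
      using F_Omega2_real[OF contract_in[OF c x, of k] contract_in[OF c z, of k] l]
      unfolding cube .
    then obtain a where a: "F (contract k c x) (Omega2 f (contract k c z) (contract k c x)) = ereal a"
      "\<bar>a - psi (contract k c x)\<bar> \<le> gam k ^ 3 * r / 6 * l"
      by (elim exE conjE)
    have err: "A * (gam k ^ 3 * r / 6 * l) \<le> M / 6 * r"
      using mult_right_mono[OF M(4)[rule_format, OF x l] r] by (simp add: A_def mult_ac)
    have "a \<le> psi (contract k c x) + gam k ^ 3 * r / 6 * l"
      "psi (contract k c x) \<le> a + gam k ^ 3 * r / 6 * l"
      using a(2) by linarith+
    then have "A * a \<le> A * psi (contract k c x) + A * (gam k ^ 3 * r / 6 * l)"
      "A * psi (contract k c x) \<le> A * a + A * (gam k ^ 3 * r / 6 * l)"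
      unfolding A_def using Acoef_nonneg[of "Suc k"]
      by (simp_all only: mult_left_mono flip: distrib_left)
    moreover have "contract k c z \<in> U" using contract_in[OF c z] by (simp add: dom_phi_def)
    then have "q x = ereal (A * a + bregman d v x + M / 6 * r)"
      by (simp add: q_def F_bar_def Omega2_f_bar[OF inner] a(1) M(1) A_def r_def)
    ultimately show ?thesis
      using err by (simp add: prox_obj_def A_def[symmetric] r_def[symmetric])
  qed
  show "prox_obj d k c v z' \<le> prox_obj d k c v w + \<alpha> / 3 * nrm B (w - z) ^ 3" if w: "w \<in> S"
  proof -
    have "q z' \<le> q w" using min_q w by (auto simp: is_arg_min_def not_less)
    then have "ereal (prox_obj d k c v z') \<le> ereal (prox_obj d k c v w + M / 3 * nrm B (w - z) ^ 3)"
      using model[OF z'] model[OF w] by (meson order_trans)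
    moreover have "M / 3 * nrm B (w - z) ^ 3 \<le> \<alpha> / 3 * nrm B (w - z) ^ 3"
      using M(3) nrm_nonneg[OF spd] by (intro mult_right_mono) auto
    ultimately show ?thesis by simp
  qed
qed

lemma cubic_newton_in:
  assumes "c \<in> S" "v \<in> S" "cubic_newton B F U f L d k c v n z" "t \<le> n"
  shows "z t \<in> S"
  using assms(2-4)
  by (cases t) (auto simp: cubic_newton_def is_arg_min_def)

lemma contracting_scheme_in:
  assumes "x0 \<in> S" "contracting_scheme B F U f L d x0 \<delta> n x v" "k \<le> n"
  shows "x k \<in> S \<and> v k \<in> S"
  using assms(3)
proof (induction k)
  case 0
  then show ?case using assms(1,2) by (simp add: contracting_scheme_def)
next
  case (Suc k)
  then have "v (Suc k) \<in> S" "x (Suc k) = contract k (x k) (v (Suc k))" "x k \<in> S"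
    using assms(2) by (auto simp: contracting_scheme_def accurate_min_def contract_def)
  then show ?case using contract_in by simp
qed

definition potential :: "('e \<Rightarrow> real) \<Rightarrow> 'e \<Rightarrow> nat \<Rightarrow> 'e \<Rightarrow> 'e \<Rightarrow> real" where
  "potential d xs k c v = Acoef k * (psi c - psi xs) + bregman d v xs"

text \<open>
  Each step multiplies the bound by a factor \<open>1 + O(1 / K)\<close>; the constant \<open>134\<close> is chosen so that the
  error \<open>\<delta> / \<tau> = 100 K \<delta>\<close> is less than \<open>75 / 100\<close> of the increment \<open>134 K \<delta>\<close> that the second
  summand allows.
\<close>

lemma potential_bound:
  assumes d: "d = prox_fun B \<alpha> x0" and x0: "x0 \<in> S" and xs: "xs \<in> S"
    and opt: "\<And>y. y \<in> S \<Longrightarrow> psi xs \<le> psi y" and \<delta>: "0 \<le> \<delta>" and K: "0 < K" "j \<le> K"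
    and scheme: "contracting_scheme B F U f L d x0 \<delta> j x v"
  shows "potential d xs j (x j) (v j) \<le> (1 + j / K) * (bregman d x0 xs + 134 * (real K)\<^sup>2 * \<delta>)"
  using K(2) scheme
proof (induction j)
  case 0
  then show ?case using \<delta> by (simp add: potential_def Acoef_def contracting_scheme_def)
next
  case (Suc j)
  define P where "P = bregman d x0 xs + 134 * (real K)\<^sup>2 * \<delta>"
  define e where "e = 1 / real K"
  define b where "b = bregman d (v (Suc j)) xs"
  define D where "D = potential d xs (Suc j) (x (Suc j)) (v (Suc j))"
  have e: "0 < e" using K by (simp add: e_def)
  have rho0: "0 \<le> bregman d x0 xs" unfolding d by (rule bregman_prox_fun_nonneg[OF spd alpha_nonneg])
  have "contracting_scheme B F U f L d x0 \<delta> j x v"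
    using Suc.prems(2) by (simp add: contracting_scheme_def)
  then have IH: "potential d xs j (x j) (v j) \<le> (1 + j * e) * P"
    using Suc.IH Suc.prems(1) by (simp add: P_def e_def)
  have xj: "x j \<in> S" "v (Suc j) \<in> S" "x (Suc j) \<in> S"
    using contracting_scheme_in[OF x0 Suc.prems(2)] by simp_all
  have x_Suc: "x (Suc j) = contract j (x j) (v (Suc j))"
    using Suc.prems(2) by (simp add: contracting_scheme_def contract_def)
  have acc: "prox_obj d j (x j) (v j) (v (Suc j)) \<le> prox_obj d j (x j) (v j) w + \<delta>" if "w \<in> S" for w
  proof -
    have "accurate_min S (h_obj F U f d j (x j) (v j)) \<delta> (v (Suc j))"
      using Suc.prems(2) by (simp add: contracting_scheme_def)
    then show ?thesis using that by (simp add: accurate_min_h_obj_iff[OF xj(1)])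
  qed
  \<comment> \<open>The terms of order \<open>\<tau>\<close> must stay a small part of the permitted relative growth \<open>1 / K\<close>.\<close>
  define \<tau> where "\<tau> = 1 / (100 * real K)"
  have \<tau>: "0 < \<tau>" "\<tau> \<le> 1" using K by (simp_all add: \<tau>_def)
  have step: "Acoef (Suc j) * psi (x (Suc j)) + bregman d (v j) (v (Suc j)) + b \<le>
      Acoef (Suc j) * psi (contract j (x j) xs) + bregman d (v j) xs + \<delta> / \<tau> +
      \<tau> * (bregman d x0 xs + 12 * b)"
    unfolding x_Suc b_def
    using acc by (intro inexact_prox_step[OF spd alpha_nonneg d convex_on_contracted_psi[OF xj(1)] xj(2) xs \<tau>])
      (simp add: prox_obj_def)
  have "0 \<le> bregman d (v j) (v (Suc j))"
    unfolding d by (rule bregman_prox_fun_nonneg[OF spd alpha_nonneg])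
  then have "D \<le> potential d xs j (x j) (v j) + \<delta> / \<tau> + \<tau> * (bregman d x0 xs + 12 * b)"
    using step Acoef_psi_contract_le[OF xj(1) xs, of j]
    by (simp add: D_def b_def potential_def algebra_simps)
  moreover have "b \<le> D"
    using opt[OF xj(3)] Acoef_nonneg[of "Suc j"] by (simp add: D_def b_def potential_def)
  then have "\<tau> * (bregman d x0 xs + 12 * b) \<le> \<tau> * (bregman d x0 xs + 12 * D)"
    using \<tau> by (intro mult_left_mono) auto
  moreover have "\<tau> * (bregman d x0 xs + 12 * D) = \<tau> * bregman d x0 xs + 12 / 100 * e * D"
    by (simp add: \<tau>_def e_def distrib_left)
  moreover have "\<delta> / \<tau> + \<tau> * bregman d x0 xs \<le> 75 / 100 * e * P"
  proof -
    have "\<delta> / \<tau> = 100 / 134 * e * (134 * (real K)\<^sup>2 * \<delta>)"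
      using K by (simp add: \<tau>_def e_def power2_eq_square)
    also have "\<dots> \<le> 75 / 100 * e * (134 * (real K)\<^sup>2 * \<delta>)"
      using e \<delta> by (intro mult_right_mono) auto
    finally have "\<delta> / \<tau> \<le> 75 / 100 * e * (134 * (real K)\<^sup>2 * \<delta>)" .
    moreover have "\<tau> * bregman d x0 xs \<le> 75 / 100 * e * bregman d x0 xs"
      using rho0 e by (intro mult_right_mono) (auto simp: \<tau>_def e_def field_simps)
    ultimately show ?thesis by (simp add: P_def distrib_left)
  qed
  ultimately have "(1 - 12 / 100 * e) * D \<le> (1 + j * e) * P + 75 / 100 * e * P"
    using IH unfolding left_diff_distrib by linarith
  also have "\<dots> \<le> (1 - 12 / 100 * e) * ((1 + Suc j * e) * P)"
  proof -
    have "Suc j * e \<le> 1" using Suc.prems(1) K by (simp add: e_def)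
    then have "12 / 100 * (1 + Suc j * e) \<le> 25 / 100" by simp
    moreover have "0 \<le> e * P" using e rho0 \<delta> by (simp add: P_def)
    ultimately have "12 / 100 * (1 + Suc j * e) * (e * P) \<le> 25 / 100 * (e * P)"
      by (rule mult_right_mono)
    moreover have "(1 - 12 / 100 * e) * ((1 + Suc j * e) * P) =
        (1 + j * e) * P + e * P - 12 / 100 * (1 + Suc j * e) * (e * P)"
      by (simp add: field_simps)
    ultimately show ?thesis by linarith
  qed
  finally have "D \<le> (1 + Suc j * e) * P"
  proof -
    assume le: "(1 - 12 / 100 * e) * D \<le> (1 - 12 / 100 * e) * ((1 + Suc j * e) * P)"
    have "e \<le> 1" using K by (simp add: e_def)
    then have "0 < 1 - 12 / 100 * e" by simp
    then show ?thesis using le by (simp only: mult_le_cancel_left_pos)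
  qed
  then show ?case by (simp add: D_def P_def e_def)
qed

text \<open>
  The first step is compared with \<open>xs\<close>: convexity and the prox term \<open>bregman d v xs\<close> turn the bound
  into the potential, whatever the objective is at \<open>v\<close>.  From then on the gap contracts.
\<close>

lemma newton_gap:
  assumes d: "d = prox_fun B \<alpha> x0" and xs: "xs \<in> S"
    and opt: "\<And>y. y \<in> S \<Longrightarrow> psi xs \<le> psi y"
    and c: "c \<in> S" and v: "v \<in> S"
    and newton: "cubic_newton B F U f L d k c v N z" and t: "Suc t \<le> N" and w: "w \<in> S"
  shows "prox_obj d k c v (z (Suc t)) \<le> prox_obj d k c v w + (7 / 8) ^ t * (3 * potential d xs k c v)"
  using t w
proof (induction t arbitrary: w)
  case 0
  have "is_arg_min (\<lambda>x. F_bar F d k c v x (Omega2 (f_bar f k c) v x)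
              + newton_const F U f L k c / 6 * ereal (nrm B (x - v) ^ 3)) (\<lambda>x. x \<in> S) (z 1)"
    using newton 0 by (auto simp: cubic_newton_def)
  from newton_step(2)[OF c v this xs]
  have "prox_obj d k c v (z 1) \<le> prox_obj d k c v xs + \<alpha> / 3 * nrm B (xs - v) ^ 3" .
  also have "\<dots> \<le> prox_obj d k c v xs + 2 * bregman d v xs"
    using bregman_prox_fun_ge[OF spd alpha_nonneg, of xs v x0] by (simp add: d)
  also have "\<dots> \<le> Acoef (Suc k) * psi xs + Acoef k * (psi c - psi xs) + 3 * bregman d v xs"
    using Acoef_psi_contract_le[OF c xs, of k] by (simp add: prox_obj_def algebra_simps)
  also have "\<dots> \<le> Acoef (Suc k) * psi xs + 3 * potential d xs k c v"
    using opt[OF c] Acoef_nonneg[of k] by (simp add: potential_def)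
  also have "Acoef (Suc k) * psi xs \<le> prox_obj d k c v w"
    using mult_left_mono[OF opt[OF contract_in[OF c 0(2)]] Acoef_nonneg[of "Suc k"], of k]
      bregman_prox_fun_nonneg[OF spd alpha_nonneg, of x0 v w]
    by (simp add: prox_obj_def d)
  finally show ?case by simp
next
  case (Suc t)
  have zt: "z (Suc t) \<in> S"
    using cubic_newton_in[OF c v newton] Suc.prems by simp
  have "is_arg_min (\<lambda>x. F_bar F d k c v x (Omega2 (f_bar f k c) (z (Suc t)) x)
              + newton_const F U f L k c / 6 * ereal (nrm B (x - z (Suc t)) ^ 3)) (\<lambda>x. x \<in> S)
         (z (Suc (Suc t)))"
    using newton Suc.prems by (auto simp: cubic_newton_def)
  note step = newton_step(2)[OF c zt this]
  have "prox_obj d k c v (z (Suc (Suc t))) \<le>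
      prox_obj d k c v w + 7 / 8 * ((7 / 8) ^ t * (3 * potential d xs k c v))"
    using Suc step
    by (intro cubic_step_contraction[OF spd alpha_nonneg d convex_on_contracted_psi[OF c] zt])
      (auto simp: prox_obj_def)
  then show ?case by simp
qed

end

section \<open>Iteration counts\<close>

lemma base_accuracy_pos: "0 < \<epsilon> \<Longrightarrow> 0 \<le> \<rho> \<Longrightarrow> 0 < base_accuracy \<epsilon> \<rho>"
  by (auto simp: base_accuracy_def)

lemma base_accuracy_le: "base_accuracy \<epsilon> \<rho> \<le> \<epsilon>"
  by (simp add: base_accuracy_def)

text \<open>
  The coefficient \<open>Acoef K = (K / 3) ^ 3\<close> reaches \<open>X\<close> at \<open>K = 3 * root 3 X\<close>.  One iteration is needed in
  any case.
\<close>

lemma outer_iterations: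
  fixes X :: real and K :: nat
  assumes X: "0 \<le> X" and K: "K = max 1 (nat \<lceil>3 * root 3 X\<rceil>)"
  shows "real K \<le> max 1 (100 * root 3 X)" "X \<le> Acoef K" "real K \<le> 4 * max 1 X"
proof -
  define R where "R = root 3 X"
  have R: "0 \<le> R" "R ^ 3 = X" using X by (simp_all add: R_def)
  have ge: "3 * R \<le> real K" unfolding K R_def[symmetric] by linarith
  have "real K = 1 \<or> real K \<le> 3 * R + 1" unfolding K R_def[symmetric] using R by linarith
  moreover have "real K = 1" if "3 * R \<le> 1"
  proof -
    have "nat \<lceil>3 * R\<rceil> \<le> 1" using that by linarith
    then show ?thesis by (simp add: K R_def[symmetric] max_absorb1)
  qed
  ultimately have le: "real K = 1 \<or> real K \<le> 3 * R + 1" "3 * R \<le> 1 \<Longrightarrow> real K = 1" by auto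
  have "real K \<le> max 1 (100 * R)"
    using le by (cases "3 * R \<le> 1") auto
  then show "real K \<le> max 1 (100 * root 3 X)" by (simp add: R_def)
  have "R ^ 3 \<le> (real K / 3) ^ 3" using ge R by (intro power_mono) auto
  then show "X \<le> Acoef K" using R by (simp add: Acoef_def)
  have "R \<le> max 1 X"
  proof (cases "R \<le> 1")
    case False
    then have "R ^ 1 \<le> R ^ 3" by (intro power_increasing) auto
    then show ?thesis using R by simp
  qed simp
  then show "real K \<le> 4 * max 1 X" using le by auto
qed

text \<open>
  With \<open>Y = max 1 X\<close>, the initial gap is at most a number below \<open>2 ^ 50\<close> times \<open>Y\<^sup>2 * \<delta>\<close>.  Since
  \<open>7 / 8 \<le> exp (- 1 / 8)\<close>, the \<open>n\<close> contractions gain at least the factor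
  \<open>exp 50 * Y\<^sup>2\<close>.
\<close>

lemma newton_iterations:
  fixes X \<epsilon> \<rho> \<delta> :: real
  assumes \<epsilon>: "0 < \<epsilon>" and X: "0 \<le> X" and \<rho>: "\<rho> = X * \<epsilon> / 3"
    and \<delta>: "\<delta> = base_accuracy \<epsilon> \<rho> / 10 ^ 9" and K: "real K \<le> 4 * max 1 X"
    and n: "400 * (1 + max 0 (ln X)) \<le> real n"
  shows "(7 / 8) ^ n * (6 * (\<rho> + 134 * (real K)\<^sup>2 * \<delta>)) \<le> \<delta>"
proof -
  define Y where "Y = max 1 X"
  have Y: "1 \<le> Y" "X \<le> Y" by (simp_all add: Y_def)
  have lnY: "ln Y = max 0 (ln X)"
    using X by (cases "X = 0"; cases "X \<le> 1") (auto simp: Y_def max_def)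
  have \<delta>0: "0 < \<delta>" using base_accuracy_pos[OF \<epsilon>, of \<rho>] X \<epsilon> by (simp add: \<delta> \<rho>)
  \<comment> \<open>\<open>\<rho> \<le> Y * \<epsilon>\<close> settles both branches of the minimum: \<open>\<rho> / \<epsilon> \<le> Y\<^sup>2\<close> and \<open>\<rho>\<^sup>2 / \<epsilon>\<^sup>2 \<le> Y\<^sup>2\<close>.\<close>
  have "\<rho> \<le> Y\<^sup>2 * base_accuracy \<epsilon> \<rho>"
  proof (cases "\<rho> = 0")
    case False
    have \<rho>Y: "0 \<le> \<rho>" "\<rho> \<le> Y * \<epsilon>"
      using X \<epsilon> Y mult_right_mono[of "X / 3" Y \<epsilon>] by (simp_all add: \<rho>)
    have "Y * \<epsilon> \<le> Y\<^sup>2 * \<epsilon>"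
      using Y \<epsilon> by (intro mult_right_mono) (auto simp: power2_eq_square)
    then have 1: "\<rho> \<le> Y\<^sup>2 * \<epsilon>" using \<rho>Y by linarith
    have "\<rho> * \<rho> \<le> (Y * \<epsilon>) * (Y * \<epsilon>)" using \<rho>Y by (intro mult_mono) auto
    then have 2: "\<rho> \<le> Y\<^sup>2 * (\<epsilon>\<^sup>2 / \<rho>)"
      using False \<rho>Y by (simp add: field_simps power2_eq_square)
    show ?thesis using 1 2 False by (simp add: base_accuracy_def min_def)
  qed (use \<epsilon> Y in \<open>simp add: base_accuracy_def\<close>)
  then have "\<rho> \<le> 1000000000 * (Y\<^sup>2 * \<delta>)" by (simp add: \<delta>)
  moreover have "134 * ((real K)\<^sup>2 * \<delta>) \<le> 2144 * (Y\<^sup>2 * \<delta>)"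
  proof -
    have "(real K)\<^sup>2 \<le> (4 * Y)\<^sup>2" using K by (intro power_mono) (auto simp: Y_def)
    from mult_right_mono[OF this, of "134 * \<delta>"] show ?thesis
      using \<delta>0 by (simp add: power_mult_distrib mult_ac)
  qed
  ultimately have "6 * (\<rho> + 134 * (real K)\<^sup>2 * \<delta>) \<le> 6000012864 * (Y\<^sup>2 * \<delta>)"
    unfolding mult.assoc distrib_left by linarith
  also have "\<dots> \<le> 2 ^ 50 * (Y\<^sup>2 * \<delta>)" using \<delta>0 by (intro mult_right_mono) auto
  finally have P: "6 * (\<rho> + 134 * (real K)\<^sup>2 * \<delta>) \<le> 2 ^ 50 * (Y\<^sup>2 * \<delta>)" .
  have "(7 / 8 :: real) ^ n \<le> exp (- 1 / 8) ^ n"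
    using exp_ge_add_one_self[of "- 1 / 8"] by (intro power_mono) auto
  also have "\<dots> = exp (- (real n / 8))" by (simp flip: exp_of_nat_mult)
  also have "\<dots> \<le> exp (- 50 - 2 * ln Y)"
    using n ln_ge_zero[OF Y(1)] unfolding lnY[symmetric] by simp
  also have "\<dots> = 1 / (exp 50 * Y\<^sup>2)"
    using Y by (simp only: exp_diff exp_minus exp_double exp_ln) (simp add: field_simps)
  finally have "(7 / 8 :: real) ^ n \<le> 1 / (exp 50 * Y\<^sup>2)" .
  then have "(7 / 8) ^ n * (6 * (\<rho> + 134 * (real K)\<^sup>2 * \<delta>)) \<le> 1 / (exp 50 * Y\<^sup>2) * (2 ^ 50 * (Y\<^sup>2 * \<delta>))"
    by (rule mult_mono[OF _ P]) (use \<delta>0 X \<epsilon> in \<open>auto simp: \<rho>\<close>)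
  also have "\<dots> = 2 ^ 50 / exp 50 * \<delta>" using Y by simp
  also have "\<dots> \<le> 1 * \<delta>"
  proof -
    have "(2 :: real) ^ 50 \<le> exp 1 ^ 50"
      using exp_ge_add_one_self[of 1] by (intro power_mono) auto
    then have "(2 :: real) ^ 50 \<le> exp 50" by (simp flip: exp_of_nat_mult)
    then show ?thesis using \<delta>0 by (intro mult_right_mono) auto
  qed
  finally show ?thesis by simp
qed

theorem corollary2:
  fixes B :: "'e::euclidean_space \<Rightarrow> ('e \<Rightarrow>\<^sub>L real)"
    and F :: "'e \<Rightarrow> real ^ 'm \<Rightarrow> ereal"
    and U :: "'e set"
    and f :: "'e \<Rightarrow> real ^ 'm"
    and L :: "real ^ 'm"
    and x0 xs :: 'e
    and \<alpha> \<epsilon> \<delta> X :: real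
    and d :: "'e \<Rightarrow> real"
  assumes "spd B"
    and "outer_fun F"
    and "inner_map B U f L"
    and "subhomogeneous_on (dom_phi F U f) F"
    and "xs \<in> dom_phi F U f"
    and "\<forall>y\<in>dom_phi F U f. phi F U f xs \<le> phi F U f y"
    and "x0 \<in> dom_phi F U f"
    and "F_sup (dom_phi F U f) F L = ereal \<alpha>"
    and "d = prox_fun B \<alpha> x0"
    and "\<epsilon> > 0"
    and "\<delta> = base_accuracy \<epsilon> (bregman d x0 xs) / 10 ^ 9"
    and "X = \<alpha> * nrm B (x0 - xs) ^ 3 / \<epsilon>"
  shows "\<exists>K N :: nat.
      real K \<le> max 1 (100 * root 3 X) \<and>
      real N \<le> 1000 * (1 + max 0 (ln X)) \<and>
      (\<forall>x v. contracting_scheme B F U f L d x0 \<delta> K x v \<longrightarrow>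
         phi F U f (x K) - phi F U f xs \<le> ereal \<epsilon>) \<and>
      (\<forall>k<K. \<forall>x v z.
         contracting_scheme B F U f L d x0 \<delta> k x v \<and>
         cubic_newton B F U f L d k (x k) (v k) N z \<longrightarrow>
         accurate_min (dom_phi F U f) (h_obj F U f d k (x k) (v k)) \<delta> (z N))"
proof -
  interpret composite_problem B F U f L \<alpha>
    using assms by unfold_locales auto
  note d = assms(9)
  note \<epsilon> = assms(10)
  define \<rho> where "\<rho> = bregman d x0 xs"
  have opt: "psi xs \<le> psi y" if "y \<in> S" for y
    using assms(5,6) that by (simp add: phi_eq_psi)
  have X: "0 \<le> X" using alpha_nonneg nrm_nonneg[OF spd] \<epsilon> by (simp add: assms(12))
  have \<rho>_eq: "\<rho> = X * \<epsilon> / 3"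
    using \<epsilon> by (simp add: \<rho>_def d bregman_prox_fun_center[OF spd] assms(12)
        nrm_minus_commute[OF spd, of x0 xs])
  have \<rho>0: "0 \<le> \<rho>" using X \<epsilon> by (simp add: \<rho>_eq)
  have \<delta>: "\<delta> = base_accuracy \<epsilon> \<rho> / 10 ^ 9" by (simp add: assms(11) \<rho>_def)
  have \<delta>0: "0 \<le> \<delta>" using base_accuracy_pos[OF \<epsilon> \<rho>0] by (simp add: \<delta>)
  have \<delta>_le: "\<delta> \<le> \<epsilon> / 10 ^ 9" using base_accuracy_le[of \<epsilon> \<rho>] by (simp add: \<delta>)
  define K where "K = max 1 (nat \<lceil>3 * root 3 X\<rceil>)"
  note K_bounds = outer_iterations[OF X K_def]
  have K: "0 < K" by (simp add: K_def)
  define P where "P = \<rho> + 134 * (real K)\<^sup>2 * \<delta>"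
  have P: "0 \<le> P" using \<rho>0 \<delta>0 by (simp add: P_def)
  have potential: "potential d xs j (x j) (v j) \<le> 2 * P"
    if "contracting_scheme B F U f L d x0 \<delta> j x v" "j \<le> K" for j x v
  proof -
    have "potential d xs j (x j) (v j) \<le> (1 + j / K) * P"
      unfolding P_def \<rho>_def
      using opt that K by (intro potential_bound[OF d assms(7,5) _ \<delta>0]) auto
    also have "\<dots> \<le> 2 * P" using that K P by (intro mult_right_mono) auto
    finally show ?thesis .
  qed
  have outer: "phi F U f (x K) - phi F U f xs \<le> ereal \<epsilon>"
    if scheme: "contracting_scheme B F U f L d x0 \<delta> K x v" for x v
  proof -
    have xK: "x K \<in> S" using contracting_scheme_in[OF assms(7) scheme] by simp
    have "Acoef K * (psi (x K) - psi xs) \<le> 2 * P"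
      using potential[OF scheme] bregman_prox_fun_nonneg[OF spd alpha_nonneg, of x0 "v K" xs]
      by (simp add: potential_def d)
    also have "\<dots> \<le> Acoef K * \<epsilon>"
    proof -
      have "2 * \<rho> \<le> 2 / 3 * (Acoef K * \<epsilon>)"
        using mult_right_mono[OF K_bounds(2), of \<epsilon>] \<epsilon> by (simp add: \<rho>_eq)
      moreover have "268 * ((real K)\<^sup>2 * \<delta>) \<le> 1 / 3 * (Acoef K * \<epsilon>)"
      proof -
        have "(real K)\<^sup>2 \<le> real K ^ 3" using K by (intro power_increasing) auto
        then have "(real K)\<^sup>2 * \<delta> \<le> real K ^ 3 * (\<epsilon> / 10 ^ 9)"
          using \<delta>0 \<delta>_le by (intro mult_mono) auto
        then have "(real K)\<^sup>2 * \<delta> \<le> real K ^ 3 * \<epsilon> / 1000000000" by simp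
        moreover have "Acoef K * \<epsilon> = real K ^ 3 * \<epsilon> / 27"
          by (simp add: Acoef_def power_divide)
        moreover have "0 \<le> real K ^ 3 * \<epsilon>" using \<epsilon> by simp
        ultimately show ?thesis by linarith
      qed
      ultimately show ?thesis unfolding P_def mult.assoc distrib_left by linarith
    qed
    finally have "psi (x K) - psi xs \<le> \<epsilon>"
      using K by (simp add: Acoef_def)
    then show ?thesis using xK assms(5) by (simp add: phi_eq_psi)
  qed
  define n where "n = nat \<lceil>400 * (1 + max 0 (ln X))\<rceil>"
  have n: "400 * (1 + max 0 (ln X)) \<le> real n" "real n \<le> 400 * (1 + max 0 (ln X)) + 1"
  proof -
    define a where "a = 400 * (1 + max 0 (ln X))"
    have "0 \<le> a" by (simp add: a_def)
    then have "a \<le> real n" "real n \<le> a + 1"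
      unfolding n_def a_def[symmetric] by linarith+
    then show "400 * (1 + max 0 (ln X)) \<le> real n" "real n \<le> 400 * (1 + max 0 (ln X)) + 1"
      by (simp_all add: a_def)
  qed
  have N: "real (Suc n) \<le> 1000 * (1 + max 0 (ln X))" using n(2) unfolding distrib_left by simp
  have inner: "accurate_min S (h_obj F U f d k (x k) (v k)) \<delta> (z (Suc n))"
    if k: "k < K" and scheme: "contracting_scheme B F U f L d x0 \<delta> k x v"
      and newton: "cubic_newton B F U f L d k (x k) (v k) (Suc n) z" for k x v z
  proof -
    have xv: "x k \<in> S" "v k \<in> S" using contracting_scheme_in[OF assms(7) scheme] by simp_all
    have "(7 / 8) ^ n * (3 * potential d xs k (x k) (v k)) \<le> (7 / 8) ^ n * (6 * P)"
      using potential[OF scheme] k by (intro mult_left_mono) auto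
    also have "\<dots> \<le> \<delta>"
      unfolding P_def by (rule newton_iterations[OF \<epsilon> X \<rho>_eq \<delta> K_bounds(3) n(1)])
    finally have "(7 / 8) ^ n * (3 * potential d xs k (x k) (v k)) \<le> \<delta>" .
    then have "prox_obj d k (x k) (v k) (z (Suc n)) \<le> prox_obj d k (x k) (v k) w + \<delta>"
      if "w \<in> S" for w
      using newton_gap[OF d assms(5) opt xv newton order_refl that] by linarith
    then show ?thesis
      using accurate_min_h_obj_iff[OF xv(1)] cubic_newton_in[OF xv newton] by simp
  qed
  show ?thesis
    using K_bounds(1) N outer inner by blast
qed

end
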